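(* Let $k\ge2$ and $n-2k\ge4$, and let $\mu_2$ be the $n$-dimensional Leibniz algebra over $\mathbb{C}$ with basis $\{e_1,\dots,e_{n-2k},f_1,\dots,f_{2k}\}$ and products $$[e_i,e_1]=e_{i+1}\ (1\le i\le n-2k-1),\quad [e_1,f_1]=e_2+f_{k+1},\quad [e_i,f_1]=e_{i+1}\ (2\le i\le n-2k-1),\quad [e_1,f_j]=f_{k+j}\ (2\le j\le k),$$ other products zero. Let $R$ be a solvable Leibniz algebra over $\mathbb{C}$ of dimension $n+1$ with nilradical $\mu_2$ and let $x$ span a complement of $\mu_2$ in $R$. Let $\mathcal{F}=\operatorname{span}\{f_1,\dots,f_k\}$ and let $\varepsilon(\mathcal{R}_x|_{\mathcal{F}}):\mathcal{F}\to\mathcal{F}$ be the composition of $\mathcal{R}_x|_{\mathcal{F}}$ with the projection onto $\mathcal{F}$ along the span of the remaining basis vectors of $\mu_2$. Assume that there is a basis of $\mathcal{F}$ in which $\varepsilon(\mathcal{R}_x|_{\mathcal{F}})$ is a single Jordan block $J_\lambda$ with $\lambda\ne0$. Then there exist $\alpha,\beta,\gamma\in\mathbb{C}$ and a basis $\{e_1,\dots,e_{n-2k},f_1,\dots,f_{2k},x\}$ of $R$ in which the multiplication table consists of the products of $\mu_2$ listed above together with $$\begin{array}{ll} [e_1,x]=f_1+\alpha f_{k+1},&\\ {}[e_2,x]=e_2+f_{k+1},&\\ {}[e_i,x]=(i-1)e_i,&3\le i\le n-2k,\\ {}[f_i,x]=-[x,f_i]=f_i+f_{i+1},&1\le i\le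 k-1,\\ {}[f_k,x]=-[x,f_k]=f_k,&\\ {}[f_{k+1},x]=f_{k+2},&\\ {}[f_i,x]=f_i+f_{i+1},&k+2\le i\le 2k-1,\\ {}[f_{2k},x]=f_{2k},&\\ {}[x,e_1]=-f_1+\beta\sum_{i=1}^{k}(-1)^{i-1}f_{k+i},&\\ {}[x,x]=\gamma f_{k+1},& \end{array}$$ all products of basis elements not listed being zero.
   Context: All algebras are finite-dimensional over $\mathbb{C}$. A (right) Leibniz algebra is a vector space $L$ with a bilinear bracket satisfying $[x,[y,z]]=[[x,y],z]-[[x,z],y]$ for all $x,y,z\in L$. $L$ is solvable if its derived series $L^{[1]}=L$, $L^{[j+1]}=[L^{[j]},L^{[j]}]$ reaches $0$, nilpotent if its lower central series $L^1=L$, $L^{j+1}=[L^j,L]$ reaches $0$. The nilradical is the maximal nilpotent ideal. $\mathcal{R}_x$ denotes right multiplication, $\mathcal{R}_x(y)=[y,x]$; it maps the nilradical to itself. *)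

theory Defs
  imports Complex_Main "Jordan_Normal_Form.Jordan_Normal_Form"
begin

locale leibniz_algebra = vector_space scale
  for scale :: "complex \<Rightarrow> 'a::ab_group_add \<Rightarrow> 'a" +
  fixes bracket :: "'a \<Rightarrow> 'a \<Rightarrow> 'a"
  assumes bracket_linear_left: "Vector_Spaces.linear scale scale (\<lambda>y. bracket y x)"
    and bracket_linear_right: "Vector_Spaces.linear scale scale (\<lambda>y. bracket x y)"
    and leibniz_identity:
      "bracket x (bracket y z) = bracket (bracket x y) z - bracket (bracket x z) y"
begin

definition product_space :: "'a set \<Rightarrow> 'a set \<Rightarrow> 'a set" where
  "product_space A B = span {bracket a b | a b. a \<in> A \<and> b \<in> B}"

text \<open>Both series are indexed from 0: \<open>derived_series A j\<close> is $A^{[j+1]}$ and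
  \<open>lower_central_series A j\<close> is $A^{j+1}$.\<close>

primrec derived_series :: "'a set \<Rightarrow> nat \<Rightarrow> 'a set" where
  "derived_series A 0 = A"
| "derived_series A (Suc j) = product_space (derived_series A j) (derived_series A j)"

primrec lower_central_series :: "'a set \<Rightarrow> nat \<Rightarrow> 'a set" where
  "lower_central_series A 0 = A"
| "lower_central_series A (Suc j) = product_space (lower_central_series A j) A"

definition solvable :: "'a set \<Rightarrow> bool" where
  "solvable A \<longleftrightarrow> (\<exists>j. derived_series A j = {0})"

definition nilpotent :: "'a set \<Rightarrow> bool" where
  "nilpotent A \<longleftrightarrow> (\<exists>j. lower_central_series A j = {0})"

definition two_sided_ideal :: "'a set \<Rightarrow> bool" where
  "two_sided_ideal I \<longleftrightarrow> subspace I \<and> (\<forall>a\<in>I. \<forall>y. bracket a y \<in> I \<and> bracket y a \<in> I)"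

text \<open>The algebra is the whole type, and its nilradical is the largest nilpotent ideal.\<close>

definition is_nilradical :: "'a set \<Rightarrow> bool" where
  "is_nilradical N \<longleftrightarrow> two_sided_ideal N \<and> nilpotent N \<and>
     (\<forall>I. two_sided_ideal I \<and> nilpotent I \<longrightarrow> I \<subseteq> N)"

definition right_mult :: "'a \<Rightarrow> 'a \<Rightarrow> 'a" where
  "right_mult x y = bracket y x"

definition is_basis :: "'a list \<Rightarrow> 'a set \<Rightarrow> bool" where
  "is_basis vs V \<longleftrightarrow> distinct vs \<and> independent (set vs) \<and> span (set vs) = V"

text \<open>The projection onto \<open>U\<close> along \<open>W\<close>; meaningful on the internal direct sum of \<open>U\<close> and \<open>W\<close>.\<close>

definition projection_along :: "'a set \<Rightarrow> 'a set \<Rightarrow> 'a \<Rightarrow> 'a" where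
  "projection_along U W v = (THE u. u \<in> U \<and> v - u \<in> W)"

text \<open>Columns of \<open>A\<close> are the coordinates of the images of the basis vectors.\<close>

definition has_matrix :: "('a \<Rightarrow> 'a) \<Rightarrow> 'a list \<Rightarrow> complex mat \<Rightarrow> bool" where
  "has_matrix \<phi> vs A \<longleftrightarrow> A \<in> carrier_mat (length vs) (length vs) \<and>
     (\<forall>j<length vs. \<phi> (vs ! j) = (\<Sum>i<length vs. scale (A $$ (i, j)) (vs ! i)))"

definition mu2_vectors :: "nat \<Rightarrow> nat \<Rightarrow> (nat \<Rightarrow> 'a) \<Rightarrow> (nat \<Rightarrow> 'a) \<Rightarrow> 'a list" where
  "mu2_vectors n k e f = map e [1..<n - 2*k + 1] @ map f [1..<2*k + 1]"

text \<open>The full multiplication table of $\mu_2$, vanishing products included.\<close>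

definition mu2_products :: "nat \<Rightarrow> nat \<Rightarrow> (nat \<Rightarrow> 'a) \<Rightarrow> (nat \<Rightarrow> 'a) \<Rightarrow> bool" where
  "mu2_products n k e f \<longleftrightarrow>
     (\<forall>i\<in>{1..n - 2*k}. \<forall>j\<in>{1..n - 2*k}.
        bracket (e i) (e j) = (if j = 1 \<and> i \<le> n - 2*k - 1 then e (i + 1) else 0)) \<and>
     (\<forall>i\<in>{1..n - 2*k}. \<forall>j\<in>{1..2*k}.
        bracket (e i) (f j) =
          (if i = 1 \<and> j = 1 then e 2 + f (k + 1)
           else if 2 \<le> i \<and> i \<le> n - 2*k - 1 \<and> j = 1 then e (i + 1)
           else if i = 1 \<and> 2 \<le> j \<and> j \<le> k then f (k + j)
           else 0)) \<and>
     (\<forall>i\<in>{1..2*k}. \<forall>j\<in>{1..n - 2*k}. bracket (f i) (e j) = 0) \<and>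
     (\<forall>i\<in>{1..2*k}. \<forall>j\<in>{1..2*k}. bracket (f i) (f j) = 0)"

end

end

theory Submission
  imports Defs
begin

text \<open>
  Put $m = n - 2k$, let $N$ be the nilradical, and write $D$ and $L$ for right and left
  multiplication by $x$, and $T = D - 1$. Every product inside $N$ has the form
  $[u,v] = \psi(v)\,S u + \epsilon(u)\,J v$, where $S$ shifts $e_i$ to $e_{i+1}$, $J$ sends $f_j$
  to $f_{k+j}$ for $j \le k$, $\epsilon$ is the $e_1$-coordinate, and $\psi$ is the sum of the
  $e_1$- and $f_1$-coordinates (\<open>bracket_N\<close>). With this formula three subspaces carry the whole
  argument: $M = [N,N]$, which is annihilated from the left by all of $R$
  (\<open>bracket_M_right\<close>); $K = \ker S$, spanned by all $f_j$ and $e_m$, which multiplies $N$ to $0$;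
  and $G$, spanned by $f_{k+1},\dots,f_{2k}$. The derivation $D$ preserves $M$ and $K$, the sum
  $Z = D + L$ maps $N$ into $M$, and $L$ vanishes on $M$. Hence $L$ is known as soon as
  $D$ and the map $Z$ on $e_1$ and $f_1,\dots,f_k$ are known. Comparing
  $[[x,e_1],f_2]$ with $[[x,f_2],e_1]$ shows that $[e_1,x]$ has no $e_1$-component
  (\<open>ce1_left_mult_zero\<close>, \<open>ce1_right_mult_zero\<close>), and then the $f_1$-component of $[e_1,x]$ must be the
  eigenvalue $\lambda$ (\<open>psi_eigenvalue\<close>).

  After division of $x$ by $\lambda$, the assumption on the Jordan block says that the
  $\mathcal{F}$-part $h$ of $[e_1,x]$ is a cyclic vector: $h, Th, \dots, T^{k-1}h$ span $K$ modulo $M$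
  and $T^k h \in M$. Such a pair $(x,h)$ is called adapted. Adaptedness survives $x \mapsto x + y$ for
  $y \in N$ with $\psi(y) = 0$, and $h \mapsto h + u$ for $u \in K \cap M$ (\<open>adapted_change\<close>).
  This freedom is used up as follows.

  \<^item> Since $T e_m = (m-2)e_m$, a multiple of $e_m$ added to $h$ brings $T^k h$ into $G$, and a
    suitable $y$ added to $x$ gives $[x,e_1] = -h + t$ with $t \in G$.
  \<^item> Now the Leibniz identity for $x, v, x$ forces $S[x,x] = 0$, $D T^k h = 0$ and
    $Z T^j h = T^j D t$. On $G$ the kernel of $D$ is a line, complementary to a subspace on which $T$ is
    nilpotent, so an element of $G$ can be added to $h$ that achieves $T^k h = 0$ and $D t = 0$
    together; then $Z T^j h = 0$ for all $j$ (\<open>normalise_chain\<close>).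
  \<^item> On $M$ modulo $G$ the map $D$ is triangular with eigenvalues $1,\dots,m-1$, so some $\xi \in M$
    satisfies $D(e_1 + \xi) \in h + G$. A last change of $x$ leaves only multiples of $J h$ in
    $D(e_1 + \xi) - h$ and in $[x,x]$; they are $\alpha$ and $\gamma$ (\<open>normalise_x\<close>).

  The basis of the theorem is $e'_i = S^{i-1}(e_1 + \xi)$, $f'_j = T^{j-1} h$, $f'_{k+j} = J f'_j$.
  Its table follows from the derivation property of $D$; the parameter $\beta$ is the position of $t$
  on the line $\ker D \cap G$, which is spanned by $\sum_i (-1)^{i-1} f'_{k+i}$.
\<close>

text \<open>Indices start at $1$, and facts about \<open>e 1\<close> and \<open>f 1\<close> should still apply after simplification.\<close>

declare One_nat_def [simp del]

section \<open>Multiplication operators of a Leibniz algebra\<close>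

context leibniz_algebra
begin

lemma bracket_hom_left: "module_hom scale scale (\<lambda>y. bracket y x)"
  by (rule module_hom_linearI[OF bracket_linear_left])

lemma bracket_hom_right: "module_hom scale scale (\<lambda>y. bracket x y)"
  by (rule module_hom_linearI[OF bracket_linear_right])

lemmas bracket_add_left = module_hom.add[OF bracket_hom_left]
  and bracket_diff_left = module_hom.diff[OF bracket_hom_left]
  and bracket_minus_left = module_hom.neg[OF bracket_hom_left]
  and bracket_scale_left = module_hom.scale[OF bracket_hom_left]
  and bracket_sum_left = module_hom.sum[OF bracket_hom_left]
  and bracket_zero_left = module_hom.zero[OF bracket_hom_left]
  and bracket_add_right = module_hom.add[OF bracket_hom_right]
  and bracket_diff_right = module_hom.diff[OF bracket_hom_right]
  and bracket_minus_right = module_hom.neg[OF bracket_hom_right]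
  and bracket_scale_right = module_hom.scale[OF bracket_hom_right]
  and bracket_sum_right = module_hom.sum[OF bracket_hom_right]
  and bracket_zero_right = module_hom.zero[OF bracket_hom_right]

lemmas bracket_simps = bracket_add_left bracket_diff_left bracket_minus_left bracket_scale_left
  bracket_zero_left bracket_add_right bracket_diff_right bracket_minus_right bracket_scale_right
  bracket_zero_right

lemma bracket_square_right: "bracket a (bracket y y) = 0"
  by (simp add: leibniz_identity)

text \<open>The sum $[y,z] + [z,y]$ is $[y+z,y+z] - [y,y] - [z,z]$, and every square is
  annihilated from the left. This is the source of all right annihilators below.\<close>

lemma bracket_symm_right: "bracket a (bracket y z + bracket z y) = 0"
  by (simp add: leibniz_identity bracket_add_right)

lemma right_mult_derivation:
  "bracket (bracket y z) x = bracket (bracket y x) z + bracket y (bracket z x)"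
  by (simp add: leibniz_identity)

text \<open>Once the eigenvalue of the Jordan block is scaled to $1$, this operator is nilpotent on the span of
  all $f_j$ modulo the derived subalgebra of $\mu_2$.\<close>

definition T :: "'a \<Rightarrow> 'a \<Rightarrow> 'a" where
  "T x v = bracket v x - v"

lemma T_hom: "module_hom scale scale (T x)"
  unfolding T_def by (unfold_locales) (simp_all add: bracket_simps algebra_simps)

lemma T_pow_hom: "module_hom scale scale (T x ^^ j)"
proof (induction j)
  case 0
  show ?case unfolding funpow_0 by unfold_locales (simp_all add: algebra_simps)
next
  case (Suc j)
  interpret a: module_hom scale scale "T x" by (rule T_hom)
  interpret b: module_hom scale scale "T x ^^ j" by (rule Suc)
  show ?case by unfold_locales (simp_all add: a.add b.add a.scale b.scale)
qed

lemmas T_simps = module_hom.add[OF T_hom] module_hom.diff[OF T_hom] module_hom.neg[OF T_hom]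
   module_hom.scale[OF T_hom] module_hom.zero[OF T_hom]
lemmas T_pow_simps = module_hom.add[OF T_pow_hom] module_hom.diff[OF T_pow_hom]
   module_hom.neg[OF T_pow_hom] module_hom.scale[OF T_pow_hom] module_hom.zero[OF T_pow_hom]

lemma bracket_eq_T: "bracket v x = T x v + v"
  by (simp add: T_def)

lemma T_pow_bracket: "(T x ^^ j) (bracket v x) = bracket ((T x ^^ j) v) x"
  by (simp add: bracket_eq_T T_pow_simps funpow_swap1)

lemma T_pow_closed:
  assumes "\<And>v. v \<in> V \<Longrightarrow> bracket v x \<in> V" and "subspace V" and "v \<in> V"
  shows "(T x ^^ j) v \<in> V"
  by (induction j) (auto simp: T_def assms subspace_diff)

lemma T_pow_eigenvector:
  assumes "bracket v x = scale a v"
  shows "(T x ^^ j) v = scale ((a - 1) ^ j) v"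
proof (induction j)
  case (Suc j)
  have "T x v = scale (a - 1) v" by (simp add: T_def assms algebra_simps)
  then show ?case by (simp add: Suc T_simps mult.commute)
qed simp

end

section \<open>The algebra $\mu_2$ in coordinates\<close>

text \<open>
  The coordinates \<open>ce i\<close> and \<open>cf j\<close> are functionals on the whole algebra, so that linearity needs no
  membership conditions; they are meant as coordinates with respect to the basis of $N$
  completed by a vector outside $N$.
\<close>

locale mu2_in_leibniz = leibniz_algebra scale bracket
  for scale :: "complex \<Rightarrow> 'a::ab_group_add \<Rightarrow> 'a" and bracket +
  fixes m k :: nat and N :: "'a set" and e f :: "nat \<Rightarrow> 'a"
    and ce cf :: "nat \<Rightarrow> 'a \<Rightarrow> complex"
  assumes m4: "m \<ge> 4" and k2: "k \<ge> 2"
    and N_ideal: "two_sided_ideal N"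
    and e_N: "i \<in> {1..m} \<Longrightarrow> e i \<in> N"
    and f_N: "j \<in> {1..2*k} \<Longrightarrow> f j \<in> N"
    and table: "mu2_products (m + 2*k) k e f"
    and ce_hom: "module_hom scale (*) (ce i)"
    and cf_hom: "module_hom scale (*) (cf i)"
    and ce_e: "\<lbrakk>i \<in> {1..m}; j \<in> {1..m}\<rbrakk> \<Longrightarrow> ce i (e j) = (if j = i then 1 else 0)"
    and ce_f: "\<lbrakk>i \<in> {1..m}; j \<in> {1..2*k}\<rbrakk> \<Longrightarrow> ce i (f j) = 0"
    and cf_e: "\<lbrakk>i \<in> {1..2*k}; j \<in> {1..m}\<rbrakk> \<Longrightarrow> cf i (e j) = 0"
    and cf_f: "\<lbrakk>i \<in> {1..2*k}; j \<in> {1..2*k}\<rbrakk> \<Longrightarrow> cf i (f j) = (if j = i then 1 else 0)"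
    and expand: "v \<in> N \<Longrightarrow>
      v = (\<Sum>i = 1..m. scale (ce i v) (e i)) + (\<Sum>j = 1..2*k. scale (cf j v) (f j))"
begin

lemmas c_simps =
  module_hom.add[OF ce_hom] module_hom.diff[OF ce_hom] module_hom.neg[OF ce_hom]
  module_hom.scale[OF ce_hom] module_hom.zero[OF ce_hom]
  module_hom.add[OF cf_hom] module_hom.diff[OF cf_hom] module_hom.neg[OF cf_hom]
  module_hom.scale[OF cf_hom] module_hom.zero[OF cf_hom]
lemmas c_sums = module_hom.sum[OF ce_hom] module_hom.sum[OF cf_hom]

definition S :: "'a \<Rightarrow> 'a" where
  "S u = (\<Sum>i = 1..<m. scale (ce i u) (e (i + 1)))"
definition J :: "'a \<Rightarrow> 'a" where
  "J v = (\<Sum>j = 1..k. scale (cf j v) (f (k + j)))"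
text \<open>On $N$ this is the functional through which the right factor acts on $e_2,\dots,e_m$:
  both $e_1$ and $f_1$ shift these vectors.\<close>

definition psi :: "'a \<Rightarrow> complex" where
  "psi v = ce 1 v + cf 1 v"

lemma S_hom: "module_hom scale scale S"
  unfolding S_def
  by unfold_locales (simp_all add: c_simps algebra_simps sum.distrib scale_sum_right)
lemma J_hom: "module_hom scale scale J"
  unfolding J_def
  by unfold_locales (simp_all add: c_simps algebra_simps sum.distrib scale_sum_right)

lemmas SJ_simps =
  module_hom.add[OF S_hom] module_hom.diff[OF S_hom] module_hom.neg[OF S_hom]
  module_hom.scale[OF S_hom] module_hom.zero[OF S_hom]
  module_hom.add[OF J_hom] module_hom.diff[OF J_hom] module_hom.neg[OF J_hom]
  module_hom.scale[OF J_hom] module_hom.zero[OF J_hom]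
lemmas SJ_sums = module_hom.sum[OF S_hom] module_hom.sum[OF J_hom]

lemma N_subspace: "subspace N"
  using N_ideal by (simp add: two_sided_ideal_def)
lemma N_bracket1: "v \<in> N \<Longrightarrow> bracket v y \<in> N"
  using N_ideal by (simp add: two_sided_ideal_def)
lemma N_bracket2: "v \<in> N \<Longrightarrow> bracket y v \<in> N"
  using N_ideal by (simp add: two_sided_ideal_def)

lemmas N_closed = N_bracket1 N_bracket2 subspace_add[OF N_subspace] subspace_diff[OF N_subspace]
  subspace_neg[OF N_subspace] subspace_scale[OF N_subspace] subspace_0[OF N_subspace]
  subspace_sum[OF N_subspace]

lemma S_N: "S u \<in> N"
  unfolding S_def by (intro N_closed e_N) auto
lemma J_N: "J u \<in> N"
  unfolding J_def by (intro N_closed f_N) auto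

lemma ce_S: "i \<in> {1..m} \<Longrightarrow> ce i (S u) = (if i = 1 then 0 else ce (i - 1) u)"
proof -
  assume i: "i \<in> {1..m}"
  have "ce i (S u) = (\<Sum>l = 1..<m. if l = i - 1 then (if i = 1 then 0 else ce (i - 1) u) else 0)"
    unfolding S_def c_sums using i
    by (intro sum.cong) (auto simp: c_simps ce_e)
  also have "\<dots> = (if i = 1 then 0 else ce (i - 1) u)"
    using i by (auto simp: sum.delta)
  finally show ?thesis .
qed

lemma cf_S: "j \<in> {1..2*k} \<Longrightarrow> cf j (S u) = 0"
  unfolding S_def c_sums by (intro sum.neutral) (auto simp: c_simps cf_e)

lemma ce_J: "i \<in> {1..m} \<Longrightarrow> ce i (J u) = 0"
  unfolding J_def c_sums by (intro sum.neutral) (auto simp: c_simps ce_f)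

lemma cf_J: "j \<in> {1..2*k} \<Longrightarrow> cf j (J u) = (if j \<le> k then 0 else cf (j - k) u)"
proof -
  assume j: "j \<in> {1..2*k}"
  have "cf j (J u) = (\<Sum>l = 1..k. if l = j - k then (if j \<le> k then 0 else cf (j - k) u) else 0)"
    unfolding J_def c_sums using j
    by (intro sum.cong) (auto simp: c_simps cf_f)
  also have "\<dots> = (if j \<le> k then 0 else cf (j - k) u)"
    using j by (auto simp: sum.delta)
  finally show ?thesis .
qed

lemma N_eqI:
  assumes "u \<in> N" "v \<in> N" "\<And>i. i \<in> {1..m} \<Longrightarrow> ce i u = ce i v"
    "\<And>j. j \<in> {1..2*k} \<Longrightarrow> cf j u = cf j v"
  shows "u = v"
proof -
  have "u = (\<Sum>i = 1..m. scale (ce i u) (e i)) + (\<Sum>j = 1..2*k. scale (cf j u) (f j))"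
    by (rule expand) fact
  also have "\<dots> = (\<Sum>i = 1..m. scale (ce i v) (e i)) + (\<Sum>j = 1..2*k. scale (cf j v) (f j))"
    using assms by simp
  also have "\<dots> = v" by (rule expand[symmetric]) fact
  finally show ?thesis .
qed

lemma bracket_ee: "\<lbrakk>i \<in> {1..m}; j \<in> {1..m}\<rbrakk> \<Longrightarrow>
    bracket (e i) (e j) = (if j = 1 \<and> i < m then e (i + 1) else 0)"
  using table unfolding mu2_products_def by auto
lemma bracket_ef: "\<lbrakk>i \<in> {1..m}; j \<in> {1..2*k}\<rbrakk> \<Longrightarrow>
    bracket (e i) (f j) = (if j = 1 \<and> i < m then e (i + 1) else 0)
      + (if i = 1 \<and> j \<le> k then f (k + j) else 0)"
proof -
  assume ij: "i \<in> {1..m}" "j \<in> {1..2*k}"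
  have "bracket (e i) (f j) = (if i = 1 \<and> j = 1 then e 2 + f (k + 1)
           else if 2 \<le> i \<and> i \<le> m - 1 \<and> j = 1 then e (i + 1)
           else if i = 1 \<and> 2 \<le> j \<and> j \<le> k then f (k + j)
           else 0)"
    using table ij unfolding mu2_products_def diff_add_inverse2 by blast
  then show ?thesis using ij m4 k2 by (auto simp: numeral_2_eq_2)
qed
lemma bracket_f: "\<lbrakk>i \<in> {1..2*k}; v \<in> N\<rbrakk> \<Longrightarrow> bracket (f i) v = 0"
proof -
  assume i: "i \<in> {1..2*k}" and v: "v \<in> N"
  have e: "bracket (f i) (e j) = 0" if "j \<in> {1..m}" for j
    using table i that unfolding mu2_products_def by simp
  have f: "bracket (f i) (f j) = 0" if "j \<in> {1..2*k}" for j
    using table i that unfolding mu2_products_def by blast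
  show ?thesis
    by (subst expand[OF v])
      (simp add: bracket_add_right bracket_sum_right bracket_scale_right e f)
qed

lemma bracket_e:
  assumes i: "i \<in> {1..m}" and v: "v \<in> N"
  shows "bracket (e i) v = scale (psi v) (if i < m then e (i + 1) else 0) + (if i = 1 then J v else 0)"
proof -
  have a: "(\<Sum>j = 1..m. scale (ce j v) (bracket (e i) (e j)))
      = (\<Sum>j = 1..m. if j = 1 then scale (ce 1 v) (if i < m then e (i + 1) else 0) else 0)"
    using i by (intro sum.cong) (auto simp: bracket_ee)
  have b: "(\<Sum>j = 1..2*k. scale (cf j v) (bracket (e i) (f j)))
      = (\<Sum>j = 1..2*k. if j = 1 then scale (cf 1 v) (if i < m then e (i + 1) else 0) else 0)
        + (\<Sum>j = 1..2*k. if i = 1 \<and> j \<le> k then scale (cf j v) (f (k + j)) else 0)"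
    unfolding sum.distrib[symmetric] using i
    by (intro sum.cong) (auto simp: bracket_ef scale_right_distrib)
  have c: "(\<Sum>j = 1..2*k. if i = 1 \<and> j \<le> k then scale (cf j v) (f (k + j)) else 0)
      = (if i = 1 then J v else 0)"
    unfolding J_def by (auto intro!: sum.mono_neutral_cong_right)
  have "bracket (e i) v = (\<Sum>j = 1..m. scale (ce j v) (bracket (e i) (e j)))
      + (\<Sum>j = 1..2*k. scale (cf j v) (bracket (e i) (f j)))"
    by (subst expand[OF v]) (simp add: bracket_add_right bracket_sum_right bracket_scale_right)
  also have "\<dots> = scale (psi v) (if i < m then e (i + 1) else 0) + (if i = 1 then J v else 0)"
    unfolding a b c using m4 k2 by (simp add: sum.delta psi_def scale_left_distrib)
  finally show ?thesis .
qed

text \<open>The two summands separate the two kinds of products of $\mu_2$: right multiplication by $e_1$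
  and $f_1$ is the same shift \<open>S\<close>, and what is left of $[e_1,f_j]$ is \<open>J (f j)\<close>.\<close>

lemma bracket_N:
  assumes u: "u \<in> N" and v: "v \<in> N"
  shows "bracket u v = scale (psi v) (S u) + scale (ce 1 u) (J v)"
proof -
  have a: "(\<Sum>i = 1..m. scale (ce i u) (scale (psi v) (if i < m then e (i + 1) else 0)))
      = scale (psi v) (S u)"
    unfolding S_def scale_sum_right
    by (rule sum.mono_neutral_cong_right) (auto simp: mult.commute)
  have b: "(\<Sum>i = 1..m. scale (ce i u) (if i = 1 then J v else 0)) = scale (ce 1 u) (J v)"
  proof -
    have "(\<Sum>i = 1..m. scale (ce i u) (if i = 1 then J v else 0))
      = (\<Sum>i = 1..m. if i = 1 then scale (ce 1 u) (J v) else 0)"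
      by (intro sum.cong) auto
    also have "\<dots> = scale (ce 1 u) (J v)" using m4 by (simp add: sum.delta)
    finally show ?thesis .
  qed
  have "bracket u v = (\<Sum>i = 1..m. scale (ce i u) (bracket (e i) v))"
    by (subst expand[OF u])
      (simp add: bracket_add_left bracket_sum_left bracket_scale_left bracket_f v)
  also have "\<dots> = (\<Sum>i = 1..m. scale (ce i u) (scale (psi v) (if i < m then e (i + 1) else 0)))
      + (\<Sum>i = 1..m. scale (ce i u) (if i = 1 then J v else 0))"
    unfolding sum.distrib[symmetric]
    by (intro sum.cong refl) (simp only: bracket_e v scale_right_distrib)
  finally show ?thesis unfolding a b .
qed

section \<open>Products of the extension that involve the nilradical\<close>

text \<open>\<open>M\<close> is the derived subalgebra $[N,N]$, \<open>K\<close> is the kernel of \<open>S\<close> on $N$, spanned by all $f_j$ and $e_m$,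
  and \<open>G\<close> is the image of \<open>J\<close>. Coordinates make their closure properties immediate.\<close>

definition M :: "'a set" where
  "M = {v \<in> N. ce 1 v = 0 \<and> (\<forall>j\<in>{1..k}. cf j v = 0)}"
definition K :: "'a set" where
  "K = {v \<in> N. \<forall>i\<in>{1..<m}. ce i v = 0}"
definition G :: "'a set" where
  "G = {v \<in> N. (\<forall>i\<in>{1..m}. ce i v = 0) \<and> (\<forall>j\<in>{1..k}. cf j v = 0)}"

lemma M_subspace: "subspace M"
  unfolding M_def by (rule subspaceI) (simp_all add: N_closed c_simps)
lemma K_subspace: "subspace K"
  unfolding K_def by (rule subspaceI) (simp_all add: N_closed c_simps)
lemma G_subspace: "subspace G"
  unfolding G_def by (rule subspaceI) (simp_all add: N_closed c_simps)

lemmas M_closed = subspace_add[OF M_subspace] subspace_diff[OF M_subspace]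
  subspace_neg[OF M_subspace] subspace_scale[OF M_subspace] subspace_0[OF M_subspace]
  subspace_sum[OF M_subspace]
lemmas K_closed = subspace_add[OF K_subspace] subspace_diff[OF K_subspace]
  subspace_neg[OF K_subspace] subspace_scale[OF K_subspace] subspace_0[OF K_subspace]
  subspace_sum[OF K_subspace]
lemmas G_closed = subspace_add[OF G_subspace] subspace_diff[OF G_subspace]
  subspace_neg[OF G_subspace] subspace_scale[OF G_subspace] subspace_0[OF G_subspace]
  subspace_sum[OF G_subspace]

lemma M_N: "v \<in> M \<Longrightarrow> v \<in> N" and K_N: "v \<in> K \<Longrightarrow> v \<in> N"
  and G_M: "v \<in> G \<Longrightarrow> v \<in> M" and G_K: "v \<in> G \<Longrightarrow> v \<in> K"
  using m4 by (auto simp: M_def K_def G_def)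

lemma K_ce1: "v \<in> K \<Longrightarrow> ce 1 v = 0" and M_ce1: "v \<in> M \<Longrightarrow> ce 1 v = 0"
  and M_cf1: "v \<in> M \<Longrightarrow> cf 1 v = 0" and M_psi: "v \<in> M \<Longrightarrow> psi v = 0"
  and K_psi: "v \<in> K \<Longrightarrow> psi v = cf 1 v"
  using m4 k2 by (auto simp: M_def K_def psi_def)

lemma psi_simps: "psi (u + v) = psi u + psi v" "psi (u - v) = psi u - psi v"
  "psi (- v) = - psi v" "psi (scale c v) = c * psi v" "psi 0 = 0"
  by (simp_all add: psi_def c_simps algebra_simps)

lemma e_M: "i \<in> {2..m} \<Longrightarrow> e i \<in> M"
  using m4 k2 e_N by (auto simp: M_def ce_e cf_e)
lemma f_K: "j \<in> {1..2*k} \<Longrightarrow> f j \<in> K"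
  using f_N by (auto simp: K_def ce_f)
lemma f_G: "j \<in> {k+1..2*k} \<Longrightarrow> f j \<in> G"
  using f_N by (auto simp: G_def cf_f ce_f)
lemma em_K: "e m \<in> K"
  using m4 e_N by (auto simp: K_def ce_e)
lemma J_G: "J v \<in> G"
  using J_N by (auto simp: G_def ce_J cf_J)
lemma S_M: "S v \<in> M"
  using S_N m4 by (auto simp: M_def ce_S cf_S)
lemma J_M: "v \<in> M \<Longrightarrow> J v = 0"
  by (auto simp: M_def J_def)
lemma S_K: "v \<in> K \<Longrightarrow> S v = 0"
  by (auto simp: K_def S_def)
lemma S_zero_K: "v \<in> N \<Longrightarrow> S v = 0 \<Longrightarrow> v \<in> K"
proof -
  assume v: "v \<in> N" and S: "S v = 0"
  have "ce i v = 0" if "i \<in> {1..<m}" for i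
    using ce_S[of "i + 1" v] that by (simp add: S c_simps)
  then show ?thesis using v by (simp add: K_def)
qed

text \<open>$K \cap M$ is the sum of \<open>G\<close> and the line of $e_m$, so modulo \<open>G\<close> a single coordinate
  controls it.\<close>

lemma M_Int_K_decomp:
  assumes "v \<in> M" "v \<in> K" shows "v - scale (ce m v) (e m) \<in> G"
  unfolding G_def
proof (intro CollectI conjI ballI)
  show "v - scale (ce m v) (e m) \<in> N" using assms m4 by (intro N_closed M_N e_N) auto
next
  fix i assume i: "i \<in> {1..m}"
  show "ce i (v - scale (ce m v) (e m)) = 0"
    using i assms m4 by (cases "i = m") (auto simp: c_simps ce_e K_def)
next
  fix j assume j: "j \<in> {1..k}"
  show "cf j (v - scale (ce m v) (e m)) = 0"
    using j assms m4 by (auto simp: c_simps cf_e M_def)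
qed

lemma S_in_K:
  assumes "S v \<in> K" shows "S v = scale (ce m (S v)) (e m)"
proof (rule N_eqI)
  show "S v \<in> N" "scale (ce m (S v)) (e m) \<in> N" using m4 by (auto intro!: N_closed S_N e_N)
next
  fix i assume i: "i \<in> {1..m}"
  show "ce i (S v) = ce i (scale (ce m (S v)) (e m))"
    using i assms m4 by (cases "i = m") (auto simp: c_simps ce_e K_def)
next
  fix j assume j: "j \<in> {1..2*k}"
  show "cf j (S v) = cf j (scale (ce m (S v)) (e m))"
    using j m4 by (simp add: c_simps cf_e cf_S)
qed

lemma S_e: "i \<in> {1..m} \<Longrightarrow> S (e i) = (if i < m then e (i + 1) else 0)"
proof -
  assume i: "i \<in> {1..m}"
  have "S (e i) = (\<Sum>l = 1..<m. if l = i then e (i + 1) else 0)"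
    unfolding S_def using i by (intro sum.cong) (auto simp: ce_e)
  then show ?thesis using i by (auto simp: sum.delta)
qed
lemma J_f: "j \<in> {1..2*k} \<Longrightarrow> J (f j) = (if j \<le> k then f (k + j) else 0)"
proof -
  assume j: "j \<in> {1..2*k}"
  have "J (f j) = (\<Sum>l = 1..k. if l = j then f (k + j) else 0)"
    unfolding J_def using j by (intro sum.cong) (auto simp: cf_f)
  then show ?thesis using j by (auto simp: sum.delta)
qed
lemma psi_e1: "psi (e 1) = 1" and psi_f1: "psi (f 1) = 1" and cf1_f1: "cf 1 (f 1) = 1"
  and ce1_e1: "ce 1 (e 1) = 1"
  using m4 k2 by (auto simp: psi_def ce_e cf_e ce_f cf_f)
lemma J_e1: "J (e 1) = 0"
  using m4 by (auto simp: J_def cf_e)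
lemma e1_N: "e 1 \<in> N" and e2_N: "e 2 \<in> N" and f1_N: "f 1 \<in> N" and f1_K: "f 1 \<in> K"
  and em_M: "e m \<in> M" and e2_M: "e 2 \<in> M"
  and Se1: "S (e 1) = e 2" and Se2: "S (e 2) = e 3"
  using m4 k2 by (auto intro!: e_N f_N f_K e_M simp: S_e one_add_one)

lemma bracket_e1: "v \<in> N \<Longrightarrow> bracket (e 1) v = scale (psi v) (e 2) + J v"
  by (simp add: bracket_N e1_N ce1_e1 Se1)
lemma bracket_right_e1: "v \<in> N \<Longrightarrow> bracket v (e 1) = S v"
  by (simp add: bracket_N e1_N psi_e1 J_e1)
lemma bracket_K_left: "u \<in> K \<Longrightarrow> v \<in> N \<Longrightarrow> bracket u v = 0"
  by (simp add: bracket_N K_N S_K K_ce1)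
lemma bracket_M_left: "u \<in> M \<Longrightarrow> v \<in> N \<Longrightarrow> bracket u v = scale (psi v) (S u)"
  by (simp add: bracket_N M_N M_ce1)

lemma M_expand:
  assumes v: "v \<in> M"
  shows "v = (\<Sum>i = 2..m. scale (ce i v) (e i)) + (\<Sum>j = k+1..2*k. scale (cf j v) (f j))"
proof -
  have "(\<Sum>i = 1..m. scale (ce i v) (e i)) = (\<Sum>i = 2..m. scale (ce i v) (e i))"
    using v by (intro sum.mono_neutral_right) (auto simp: M_def not_le less_Suc_eq numeral_2_eq_2 One_nat_def)
  moreover have "(\<Sum>j = 1..2*k. scale (cf j v) (f j)) = (\<Sum>j = k+1..2*k. scale (cf j v) (f j))"
    using v by (intro sum.mono_neutral_right) (auto simp: M_def)
  ultimately show ?thesis using expand[OF M_N[OF v]] by simp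
qed

lemma G_expand: "v \<in> G \<Longrightarrow> v = J (\<Sum>j = 1..k. scale (cf (k + j) v) (f j))"
proof -
  assume v: "v \<in> G"
  have "v = (\<Sum>i = 2..m. scale (ce i v) (e i)) + (\<Sum>j = k+1..2*k. scale (cf j v) (f j))"
    using v by (intro M_expand G_M)
  also have "(\<Sum>i = 2..m. scale (ce i v) (e i)) = 0"
    using v by (intro sum.neutral) (auto simp: G_def)
  also have "(\<Sum>j = k+1..2*k. scale (cf j v) (f j)) = (\<Sum>j = 1..k. scale (cf (k + j) v) (f (k + j)))"
    using sum.shift_bounds_cl_nat_ivl[of "\<lambda>j. scale (cf j v) (f j)" 1 k k]
    by (simp add: mult_2 add.commute)
  also have "\<dots> = J (\<Sum>j = 1..k. scale (cf (k + j) v) (f j))"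
    unfolding SJ_sums by (intro sum.cong) (auto simp: SJ_simps J_f)
  finally show ?thesis by simp
qed

text \<open>Each of $e_2,\dots,e_m,f_{k+1},\dots,f_{2k}$ is, up to such vectors already treated, a
  symmetrised product: $e_2 = [e_1,e_1]$, $e_{i+1} = [e_i,e_1] + [e_1,e_i]$, and
  $[e_1,f_j] + [f_j,e_1]$ is $f_{k+j}$ or $e_2 + f_{k+1}$.\<close>

lemma bracket_M_right: assumes v: "v \<in> M" shows "bracket a v = 0"
proof -
  have e2: "bracket a (e 2) = 0"
    using bracket_square_right[of a "e 1"] by (simp add: bracket_right_e1 e1_N Se1)
  have e: "bracket a (e i) = 0" if i: "i \<in> {2..m}" for i
  proof (cases "i = 2")
    case False
    then have i': "i - 1 \<in> {2..m}" "i - 1 < m" "i - 1 + 1 = i" using i by auto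
    have "bracket (e 1) (e (i - 1)) = 0"
      using e_M[OF i'(1)] by (simp add: bracket_e1 M_N M_psi J_M)
    moreover have "bracket (e (i - 1)) (e 1) = e i"
      using e_M[OF i'(1)] i' by (simp add: bracket_right_e1 M_N S_e)
    ultimately show ?thesis using bracket_symm_right[of a "e 1" "e (i - 1)"] by simp
  qed (simp add: e2)
  have f: "bracket a (f (k + j)) = 0" if j: "j \<in> {1..k}" for j
  proof -
    have "bracket (e 1) (f j) + bracket (f j) (e 1) = scale (psi (f j)) (e 2) + f (k + j)"
      using j f_K[of j] by (simp add: bracket_e1 K_N bracket_right_e1 J_f S_K)
    from bracket_symm_right[of a "e 1" "f j", unfolded this]
    show ?thesis by (simp add: bracket_simps e2)
  qed
  have f': "bracket a (f j) = 0" if j: "j \<in> {k+1..2*k}" for j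
  proof -
    have "j - k \<in> {1..k}" "k + (j - k) = j" using j by auto
    then show ?thesis using f[of "j - k"] by simp
  qed
  show ?thesis
    by (subst M_expand[OF v])
      (simp add: bracket_add_right bracket_sum_right bracket_scale_right e f')
qed

text \<open>The element $e_1$ alone detects membership in \<open>M\<close>, because
  $[e_1,v] = \psi(v) e_2 + J v$ reads off all coordinates of $v$ that vanish on \<open>M\<close>.\<close>

lemma right_annihilated_M:
  assumes v: "v \<in> N" and z: "bracket (e 1) v = 0" shows "v \<in> M"
proof -
  have eq: "scale (psi v) (e 2) + J v = 0" using z by (simp add: bracket_e1 v)
  have psi: "psi v = 0"
    using arg_cong[OF eq, of "ce 2"] m4 by (simp add: c_simps ce_e ce_J)
  have "J v = 0" using eq psi by simp
  then have f: "cf j v = 0" if "j \<in> {1..k}" for j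
    using cf_J[of "k + j" v] that by (simp add: c_simps)
  show ?thesis using v psi f f[of 1] k2 by (auto simp: M_def psi_def)
qed

lemma bracket_N_M: "u \<in> N \<Longrightarrow> v \<in> N \<Longrightarrow> bracket u v \<in> M"
  by (simp add: bracket_N M_closed S_M J_G[THEN G_M])

text \<open>The failure of anticommutativity with $x$. It is smaller than either
  multiplication: it maps $N$ into \<open>M\<close>, and on \<open>M\<close> it is right multiplication.\<close>

definition Z :: "'a \<Rightarrow> 'a \<Rightarrow> 'a" where
  "Z x v = bracket v x + bracket x v"

lemma Z_simps: "Z x (u + v) = Z x u + Z x v" "Z x (u - v) = Z x u - Z x v"
  "Z x (- v) = - Z x v" "Z x (scale c v) = scale c (Z x v)" "Z x 0 = 0"
  by (simp_all add: Z_def bracket_simps algebra_simps)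

lemma Z_M: "v \<in> N \<Longrightarrow> Z x v \<in> M"
  by (rule right_annihilated_M) (simp_all add: Z_def N_closed bracket_symm_right)

lemma Z_on_M: "v \<in> M \<Longrightarrow> Z x v = bracket v x"
  by (simp add: Z_def bracket_M_right)

lemma M_invariant: assumes v: "v \<in> M" shows "bracket v x \<in> M"
proof (rule right_annihilated_M)
  show "bracket v x \<in> N" using v by (intro N_closed M_N)
  show "bracket (e 1) (bracket v x) = 0"
    using v by (simp add: leibniz_identity bracket_M_right bracket_zero_left)
qed

lemma K_invariant: assumes v: "v \<in> K" shows "bracket v x \<in> K"
proof (rule S_zero_K)
  show N: "bracket v x \<in> N" using v by (intro N_closed K_N)
  have "bracket (bracket v (e 1)) x = bracket (bracket v x) (e 1) + bracket v (bracket (e 1) x)"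
    by (rule right_mult_derivation)
  then show "S (bracket v x) = 0"
    using v by (simp add: bracket_K_left e1_N N N_closed bracket_zero_left bracket_right_e1)
qed

lemma right_mult_e2: "bracket (e 2) x
    = S (bracket (e 1) x) + scale (psi (bracket (e 1) x)) (e 2) + J (bracket (e 1) x)"
  using right_mult_derivation[of "e 1" "e 1" x]
  by (simp add: bracket_right_e1 bracket_e1[of "bracket (e 1) x"] e1_N N_closed Se1 add.assoc)

text \<open>The derivation property applied to $S v = [v,e_1]$; the coordinate of $v$ at $e_1$ is excluded since
  it would bring in the \<open>J\<close>-part of $[e_1,x]$.\<close>

lemma right_mult_S: assumes "v \<in> N" "ce 1 v = 0"
  shows "bracket (S v) x = S (bracket v x) + scale (psi (bracket (e 1) x)) (S v)"
  using right_mult_derivation[of v "e 1" x] assms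
  by (simp add: bracket_right_e1 bracket_N[of v "bracket (e 1) x"] e1_N N_closed)

text \<open>Apply the derivation to $[e_2,v] = \psi(v) e_3$ and to $e_3 = [e_2,e_1]$, and compare the
  coefficients at $e_3$.\<close>

lemma cf1_right_mult: assumes v: "v \<in> K"
  shows "cf 1 (bracket v x) = psi (bracket (e 1) x) * cf 1 v"
proof -
  have b: "bracket (e 2) u = scale (psi u) (e 3)" if "u \<in> N" for u
    using that by (simp add: bracket_M_left e2_M Se2)
  have De2: "bracket (e 2) x \<in> M" by (intro M_invariant e2_M)
  have "bracket (bracket (e 2) v) x = bracket (bracket (e 2) x) v + bracket (e 2) (bracket v x)"
    by (rule right_mult_derivation)
  then have "scale (cf 1 v) (bracket (e 3) x)
      = scale (cf 1 v) (S (bracket (e 2) x)) + scale (cf 1 (bracket v x)) (e 3)"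
    using v K_invariant[OF v, of x]
    by (simp add: b K_N bracket_simps bracket_M_left[OF De2] K_psi)
  moreover have "bracket (e 3) x = S (bracket (e 2) x) + scale (psi (bracket (e 1) x)) (e 3)"
    using right_mult_S[of "e 2" x] by (simp add: e2_N M_ce1 e2_M Se2)
  ultimately have "scale (cf 1 v * psi (bracket (e 1) x)) (e 3) = scale (cf 1 (bracket v x)) (e 3)"
    by (simp add: algebra_simps)
  from arg_cong[OF this, of "ce 3"] show ?thesis
    using m4 by (simp add: c_simps ce_e mult.commute)
qed

lemma bracket_left_commute:
  "u \<in> N \<Longrightarrow> v \<in> N \<Longrightarrow> bracket (bracket x u) v = bracket (bracket x v) u"
  using leibniz_identity[of x u v] by (simp add: bracket_M_right bracket_N_M)

text \<open>Since $[e_1,v] \in M$ is annihilated by $x$, the Leibniz identity makes $[[x,e_1],v]$ symmetric: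
  it equals $[[x,v],e_1] = S[x,v]$.\<close>

lemma S_Z_symmetry: assumes v: "v \<in> K"
  shows "S (Z x v) = scale (cf 1 v) (S (bracket x (e 1))) + scale (ce 1 (bracket x (e 1))) (J v)"
proof -
  have "S (Z x v) = S (bracket x v)"
    by (simp add: Z_def SJ_simps S_K K_invariant v)
  also have "\<dots> = bracket (bracket x v) (e 1)"
    using v by (simp add: bracket_right_e1 N_closed K_N)
  also have "\<dots> = bracket (bracket x (e 1)) v"
    using v by (intro bracket_left_commute) (auto simp: e1_N K_N)
  also have "\<dots> = scale (cf 1 v) (S (bracket x (e 1))) + scale (ce 1 (bracket x (e 1))) (J v)"
    using v by (simp add: bracket_N N_closed e1_N K_N K_psi)
  finally show ?thesis .
qed

text \<open>In the previous identity for $v = f_2$ the vectors in the image of \<open>S\<close> have no component at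
  $f_{k+2} = J f_2$, so its coefficient vanishes. This is where $k \ge 2$ enters.\<close>

lemma ce1_left_mult_zero: "ce 1 (bracket x (e 1)) = 0"
proof -
  have v: "f 2 \<in> K" using k2 by (intro f_K) auto
  have "cf (k + 2) (S (Z x (f 2))) = 0" using k2 by (intro cf_S) auto
  moreover have "cf (k + 2) (S (bracket x (e 1))) = 0" using k2 by (intro cf_S) auto
  moreover have "cf (k + 2) (J (f 2)) = 1" using k2 by (simp add: cf_J cf_f)
  ultimately show ?thesis
    using arg_cong[OF S_Z_symmetry[OF v, of x], of "cf (k + 2)"] by (simp add: c_simps)
qed

lemma S_Z: "v \<in> K \<Longrightarrow> S (Z x v) = scale (cf 1 v) (S (bracket x (e 1)))"
  by (simp add: S_Z_symmetry ce1_left_mult_zero)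

lemma ce1_right_mult_zero: "ce 1 (bracket (e 1) x) = 0"
  using M_ce1[OF Z_M[OF e1_N, of x]] by (simp add: Z_def c_simps ce1_left_mult_zero)

lemma psi_right_mult_e1: "psi (bracket (e 1) x) = cf 1 (bracket (e 1) x)"
  by (simp add: psi_def ce1_right_mult_zero)

text \<open>Apply the derivation to $[e_1,v] = \psi(v) e_2 + J v$ and subtract the formula for $[e_2,x]$; all
  multiples of $e_2$ cancel.\<close>

lemma right_mult_J: assumes v: "v \<in> K"
  shows "bracket (J v) x = J (bracket v x) - scale (cf 1 v) (J (bracket (e 1) x))"
proof -
  have Dv: "bracket v x \<in> K" by (intro K_invariant v)
  have De1: "bracket (e 1) x \<in> N" by (intro N_closed e1_N)
  have "bracket (bracket (e 1) v) x
      = bracket (bracket (e 1) x) v + bracket (e 1) (bracket v x)"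
    by (rule right_mult_derivation)
  then have "scale (cf 1 v) (bracket (e 2) x) + bracket (J v) x
      = scale (cf 1 v) (S (bracket (e 1) x))
        + (scale (psi (bracket (e 1) x) * cf 1 v) (e 2) + J (bracket v x))"
    using v Dv
    by (simp add: bracket_e1 K_N bracket_simps K_psi cf1_right_mult bracket_N[OF De1] ce1_right_mult_zero)
  then show ?thesis unfolding right_mult_e2
    by (simp add: algebra_simps)
qed

lemma Z_right_mult: "Z x (bracket v x) = bracket (Z x v) x - bracket (bracket x x) v"
  unfolding Z_def using leibniz_identity[of x v x] by (simp add: bracket_simps)

lemma bracket_add_psi0:
  assumes "y \<in> N" "psi y = 0" "v \<in> N"
  shows "bracket v (x + y) = bracket v x + scale (ce 1 v) (J y)"
  using assms by (simp add: bracket_simps bracket_N)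

section \<open>Adapted pairs\<close>

text \<open>\<open>h\<close> is the part of $[e_1,x]$ outside \<open>M\<close>, with $f_1$-coordinate $1$ (the normalised eigenvalue), and
  it is a cyclic vector for $T$ on $K$ modulo \<open>M\<close>, as a Jordan block of size $k$ with eigenvalue $1$
  would have it.\<close>

definition adapted :: "'a \<Rightarrow> 'a \<Rightarrow> bool" where
  "adapted x h \<longleftrightarrow> bracket x x \<in> N \<and> h \<in> K \<and> cf 1 h = 1 \<and> bracket (e 1) x - h \<in> M \<and>
     (T x ^^ k) h \<in> M \<and> (\<forall>v\<in>K. \<exists>c. v - (\<Sum>j<k. scale (c j) ((T x ^^ j) h)) \<in> M)"

lemma T_pow_K: "v \<in> K \<Longrightarrow> (T x ^^ j) v \<in> K"
  by (rule T_pow_closed[OF K_invariant K_subspace])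
lemma T_pow_M: "v \<in> M \<Longrightarrow> (T x ^^ j) v \<in> M"
  by (rule T_pow_closed[OF M_invariant M_subspace])
lemma T_K: "v \<in> K \<Longrightarrow> T x v \<in> K"
  using T_pow_K[of v "Suc 0" x] by simp

lemma bracket_add_K:
  "y \<in> N \<Longrightarrow> psi y = 0 \<Longrightarrow> v \<in> K \<Longrightarrow> bracket v (x + y) = bracket v x"
  by (simp add: bracket_simps bracket_K_left)

lemma T_pow_add_K:
  assumes "y \<in> N" "psi y = 0" "v \<in> K"
  shows "(T (x + y) ^^ j) v = (T x ^^ j) v"
proof (induction j)
  case (Suc j)
  have "T (x + y) ((T x ^^ j) v) = T x ((T x ^^ j) v)"
    using assms by (simp add: T_def bracket_add_K T_pow_K)
  then show ?case by (simp add: Suc)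
qed simp

text \<open>Right multiplication by $y$ with $\psi(y) = 0$ kills everything in $N$ except $e_1$, which it sends
  into \<open>G\<close>. So $D$ changes neither on \<open>K\<close> nor on \<open>M\<close>.\<close>

lemma adapted_change:
  assumes ad: "adapted x h" and y: "y \<in> N" "psi y = 0" and u: "u \<in> K" "u \<in> M"
  shows "adapted (x + y) (h + u)"
  unfolding adapted_def
proof (intro conjI ballI)
  have h: "h \<in> K" "cf 1 h = 1" "bracket (e 1) x - h \<in> M" "(T x ^^ k) h \<in> M" "bracket x x \<in> N"
    using ad by (auto simp: adapted_def)
  have pow: "(T (x + y) ^^ j) (h + u) = (T x ^^ j) h + (T x ^^ j) u" for j
    using y u h by (simp add: T_pow_add_K K_closed T_pow_simps)
  show "bracket (x + y) (x + y) \<in> N"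
    using h y by (simp add: bracket_simps N_closed)
  show "h + u \<in> K" using h u by (simp add: K_closed)
  show "cf 1 (h + u) = 1" using h u by (simp add: c_simps M_cf1)
  have "bracket (e 1) (x + y) - (h + u) = (bracket (e 1) x - h) + J y - u"
    using y by (simp add: bracket_add_psi0 e1_N ce1_e1)
  also have "\<dots> \<in> M"
    by (rule M_closed(2)[OF M_closed(1)[OF h(3) J_G[THEN G_M]] u(2)])
  finally show "bracket (e 1) (x + y) - (h + u) \<in> M" .
  show "(T (x + y) ^^ k) (h + u) \<in> M"
    unfolding pow using h u by (simp add: M_closed T_pow_M)
  fix v assume "v \<in> K"
  then obtain c where c: "v - (\<Sum>j<k. scale (c j) ((T x ^^ j) h)) \<in> M"
    using ad by (auto simp: adapted_def)
  have "v - (\<Sum>j<k. scale (c j) ((T (x + y) ^^ j) (h + u)))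
      = v - (\<Sum>j<k. scale (c j) ((T x ^^ j) h)) - (\<Sum>j<k. scale (c j) ((T x ^^ j) u))"
    unfolding pow by (simp add: scale_right_distrib sum.distrib)
  also have "\<dots> \<in> M"
    by (rule M_closed(2)[OF c]) (intro M_closed T_pow_M u)
  finally show "\<exists>c. v - (\<Sum>j<k. scale (c j) ((T (x + y) ^^ j) (h + u))) \<in> M" by blast
qed

context
  fixes x h
  assumes ad: "adapted x h"
begin

lemma adapted_props: "h \<in> K" "cf 1 h = 1" "bracket (e 1) x - h \<in> M" "(T x ^^ k) h \<in> M" "bracket x x \<in> N"
  using ad by (auto simp: adapted_def)

lemma adapted_psi_e1: "psi (bracket (e 1) x) = 1"
proof -
  have "psi (bracket (e 1) x) = psi (bracket (e 1) x - h) + psi h" by (simp add: psi_simps)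
  then show ?thesis using adapted_props by (simp add: M_psi K_psi)
qed

lemma adapted_cf1_T: "v \<in> K \<Longrightarrow> cf 1 (T x v) = 0"
  by (simp add: T_def c_simps cf1_right_mult adapted_psi_e1)

lemma adapted_cf1_T_pow: "j > 0 \<Longrightarrow> cf 1 ((T x ^^ j) h) = 0"
  by (cases j) (simp_all add: adapted_cf1_T T_pow_K adapted_props)

lemma adapted_J_right_mult_e1: "J (bracket (e 1) x) = J h"
proof -
  have "J (bracket (e 1) x) = J (bracket (e 1) x - h) + J h" by (simp add: SJ_simps)
  then show ?thesis using adapted_props by (simp add: J_M)
qed

lemma adapted_S_right_mult_e1: "S (bracket (e 1) x) = S (bracket (e 1) x - h)"
  by (simp add: SJ_simps S_K adapted_props)

text \<open>The vectors $g_j = J T^j h$, for $j < k$, span \<open>G\<close>, and $D$ acts on them by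
  $g_0 \mapsto g_1$ and $g_j \mapsto g_j + g_{j+1}$ for $j > 0$: the Jordan block of $h$ is copied, except that
  the eigenvalue of the first vector drops to $0$.\<close>

lemma adapted_right_mult_Jh: "bracket (J h) x = J (T x h)"
  by (simp add: right_mult_J adapted_props adapted_J_right_mult_e1 T_def SJ_simps)

lemma adapted_right_mult_J: "v \<in> K \<Longrightarrow> cf 1 v = 0 \<Longrightarrow> bracket (J v) x = J v + J (T x v)"
  by (simp add: right_mult_J T_def SJ_simps)

lemma adapted_right_mult_g: "j > 0 \<Longrightarrow>
    bracket (J ((T x ^^ j) h)) x = J ((T x ^^ j) h) + J ((T x ^^ Suc j) h)"
  by (simp add: adapted_right_mult_J adapted_cf1_T_pow T_pow_K adapted_props)

lemma adapted_g_zero: "j \<ge> k \<Longrightarrow> J ((T x ^^ j) h) = 0"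
proof -
  assume j: "j \<ge> k"
  have "(T x ^^ j) h = (T x ^^ (j - k)) ((T x ^^ k) h)"
    using j by (simp add: funpow_add[symmetric, unfolded o_def, THEN fun_cong])
  then show ?thesis using adapted_props by (simp add: J_M T_pow_M)
qed

lemma adapted_T_pow_g: "j > 0 \<Longrightarrow> (T x ^^ i) (J ((T x ^^ j) h)) = J ((T x ^^ (i + j)) h)"
proof (induction i)
  case (Suc i)
  then show ?case using adapted_right_mult_g[of "i + j"] by (simp add: T_def[of x "J _"])
qed simp

lemma adapted_T_pow_g_zero: "j > 0 \<Longrightarrow> (T x ^^ k) (J ((T x ^^ j) h)) = 0"
  by (simp add: adapted_T_pow_g adapted_g_zero)

lemma adapted_G_span:
  assumes v: "v \<in> G" obtains c where "v = (\<Sum>j<k. scale (c j) (J ((T x ^^ j) h)))"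
proof -
  define u where "u = (\<Sum>j = 1..k. scale (cf (k + j) v) (f j))"
  have u: "u \<in> K" unfolding u_def by (intro K_closed f_K) auto
  then obtain c where c: "u - (\<Sum>j<k. scale (c j) ((T x ^^ j) h)) \<in> M"
    using ad by (auto simp: adapted_def)
  have "v = J u" unfolding u_def by (rule G_expand[OF v])
  also have "\<dots> = J (u - (\<Sum>j<k. scale (c j) ((T x ^^ j) h))) + J (\<Sum>j<k. scale (c j) ((T x ^^ j) h))"
    by (simp add: SJ_simps)
  also have "\<dots> = (\<Sum>j<k. scale (c j) (J ((T x ^^ j) h)))"
    using J_M[OF c] by (simp add: SJ_sums SJ_simps)
  finally show ?thesis by (rule that)
qed

lemma adapted_G_invariant: assumes v: "v \<in> G" shows "bracket v x \<in> G"
proof -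
  have "v = J (\<Sum>j = 1..k. scale (cf (k + j) v) (f j))" (is "v = J ?u") by (rule G_expand[OF v])
  moreover have "?u \<in> K" by (intro K_closed f_K) auto
  ultimately show ?thesis using right_mult_J[of ?u x] by (simp add: G_closed J_G)
qed

text \<open>$D$ maps \<open>G\<close> into the span of the $g_j$ with $j > 0$, on which $T^k = 0$; and $D$ commutes
  with $T$.\<close>

lemma adapted_right_mult_T_pow_G_zero: assumes v: "v \<in> G" shows "bracket ((T x ^^ k) v) x = 0"
proof -
  obtain c where c: "v = (\<Sum>j<k. scale (c j) (J ((T x ^^ j) h)))" using adapted_G_span[OF v] .
  have z: "bracket ((T x ^^ k) (J ((T x ^^ j) h))) x = 0" for j
  proof (cases "j = 0")
    case True
    have "bracket ((T x ^^ k) (J h)) x = (T x ^^ k) (J ((T x ^^ Suc 0) h))"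
      by (simp add: T_pow_bracket[symmetric] adapted_right_mult_Jh)
    then show ?thesis using True adapted_T_pow_g_zero[of "Suc 0"] by simp
  next
    case False
    then show ?thesis by (simp add: adapted_T_pow_g_zero bracket_zero_left)
  qed
  show ?thesis unfolding c
    by (simp add: module_hom.sum[OF T_pow_hom] T_pow_simps bracket_sum_left bracket_scale_left z)
qed

text \<open>Solve upwards along the chain: $g_1 = D g_0$, and $g_{j+1} = D g_j - g_j$ for $j > 0$.\<close>

lemma adapted_g_in_image: "j > 0 \<Longrightarrow> \<exists>u\<in>G. bracket u x = J ((T x ^^ j) h)"
proof (induction j)
  case (Suc j)
  show ?case
  proof (cases "j = 0")
    case True
    show ?thesis by (rule bexI[of _ "J h"]) (simp_all add: True adapted_right_mult_Jh J_G)
  next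
    case False
    then obtain u where u: "u \<in> G" "bracket u x = J ((T x ^^ j) h)" using Suc by auto
    show ?thesis
      by (rule bexI[of _ "J ((T x ^^ j) h) - u"])
        (use False u adapted_right_mult_g[of j] in \<open>simp_all add: bracket_simps G_closed J_G\<close>)
  qed
qed simp

text \<open>What a change of $x$ can remove from an element of \<open>G\<close>. The remainder \<open>J y\<close> is offered in two forms,
  because $[e_1,x]$ is corrected by right multiplication with \<open>y\<close>, while $[x,x]$ is corrected by a
  value of $D$.\<close>

lemma adapted_G_decomp:
  assumes v: "v \<in> G"
  obtains \<alpha> y u where "y \<in> K" "cf 1 y = 0" "u \<in> G" "v = scale \<alpha> (J h) + J y" "J y = bracket u x"
proof -
  obtain c where c: "v = (\<Sum>j<k. scale (c j) (J ((T x ^^ j) h)))" using adapted_G_span[OF v] .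
  obtain w where w: "\<And>j. j > 0 \<Longrightarrow> w j \<in> G \<and> bracket (w j) x = J ((T x ^^ j) h)"
    using adapted_g_in_image by metis
  define y where "y = (\<Sum>j = 1..<k. scale (c j) ((T x ^^ j) h))"
  define u where "u = (\<Sum>j = 1..<k. scale (c j) (w j))"
  have Jy: "J y = (\<Sum>j = 1..<k. scale (c j) (J ((T x ^^ j) h)))"
    by (simp add: y_def SJ_sums SJ_simps)
  have "y \<in> K" unfolding y_def by (intro K_closed T_pow_K adapted_props)
  moreover have "cf 1 y = 0"
    unfolding y_def c_sums by (intro sum.neutral) (simp add: c_simps adapted_cf1_T_pow)
  moreover have "u \<in> G" unfolding u_def using w by (intro G_closed) auto
  moreover have "{..<k} = insert 0 {1..<k}" using k2 by auto
  then have "v = scale (c 0) (J h) + J y" unfolding c Jy by simp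
  moreover have "J y = bracket u x" unfolding Jy u_def bracket_sum_left
    by (intro sum.cong refl) (simp add: bracket_scale_left w)
  ultimately show ?thesis by (rule that)
qed

lemma adapted_alternating_telescope: "(\<Sum>j<Suc n. scale ((- 1) ^ j) (bracket (J ((T x ^^ j) h)) x))
    = scale ((- 1) ^ n) (J ((T x ^^ Suc n) h))"
proof (induction n)
  case 0
  show ?case by (simp add: adapted_right_mult_Jh)
next
  case (Suc n)
  show ?case
    unfolding sum.lessThan_Suc[of _ "Suc n"] Suc using adapted_right_mult_g[of "Suc n"]
    by (simp add: scale_right_distrib)
qed

text \<open>Subtract from \<open>v\<close> the multiple of the alternating sum $s$ that cancels its $g_0$-term. The
  difference $r$ satisfies $D r = 0$, that is $T r = -r$, but also $T^k r = 0$; hence $r = 0$.\<close>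

lemma adapted_G_kernel:
  assumes v: "v \<in> G" and Dv: "bracket v x = 0"
  obtains \<beta> where "v = scale \<beta> (\<Sum>j<k. scale ((- 1) ^ j) (J ((T x ^^ j) h)))"
proof -
  define s where "s = (\<Sum>j<k. scale ((- 1) ^ j) (J ((T x ^^ j) h)))"
  obtain c where c: "v = (\<Sum>j<k. scale (c j) (J ((T x ^^ j) h)))" using adapted_G_span[OF v] .
  have Ds: "bracket s x = 0"
    using adapted_alternating_telescope[of "k - 1"] k2 adapted_g_zero[of k]
    by (simp add: s_def bracket_sum_left bracket_scale_left)
  define r where "r = v - scale (c 0) s"
  have Dr: "bracket r x = 0" by (simp add: r_def bracket_simps Dv Ds)
  have r: "r = (\<Sum>j<k. scale (c j - c 0 * (- 1) ^ j) (J ((T x ^^ j) h)))"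
    unfolding r_def c s_def by (simp add: scale_sum_right sum_subtractf scale_left_diff_distrib)
  have "(T x ^^ k) r = (\<Sum>j<k. scale (c j - c 0 * (- 1) ^ j) ((T x ^^ k) (J ((T x ^^ j) h))))"
    by (subst r) (simp only: module_hom.sum[OF T_pow_hom] T_pow_simps)
  also have "\<dots> = 0"
  proof (intro sum.neutral ballI)
    fix j
    show "scale (c j - c 0 * (- 1) ^ j) ((T x ^^ k) (J ((T x ^^ j) h))) = 0"
      by (cases "j = 0") (simp_all add: adapted_T_pow_g_zero)
  qed
  finally have "scale ((- 1) ^ k) r = 0"
    using T_pow_eigenvector[of r x 0 k] Dr by simp
  then have "r = 0" by simp
  then show ?thesis using that[of "c 0"] by (simp add: r_def s_def)
qed

end

text \<open>The span of $e_i,\dots,e_m$. Along this filtration $D$ is triangular.\<close>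

definition E :: "nat \<Rightarrow> 'a set" where
  "E i = {v \<in> N. (\<forall>l\<in>{1..m}. l < i \<longrightarrow> ce l v = 0) \<and> (\<forall>j\<in>{1..2*k}. cf j v = 0)}"

lemma E_subspace: "subspace (E i)"
  unfolding E_def by (rule subspaceI) (simp_all add: N_closed c_simps)
lemmas E_closed = subspace_add[OF E_subspace] subspace_diff[OF E_subspace]
  subspace_neg[OF E_subspace] subspace_scale[OF E_subspace] subspace_0[OF E_subspace]
  subspace_sum[OF E_subspace]

lemma E_mono: "i \<le> j \<Longrightarrow> v \<in> E j \<Longrightarrow> v \<in> E i"
  by (auto simp: E_def)
lemma E_M: "i \<ge> 2 \<Longrightarrow> v \<in> E i \<Longrightarrow> v \<in> M"
  using m4 by (auto simp: E_def M_def)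
lemma S_E: "v \<in> E i \<Longrightarrow> S v \<in> E (i + 1)"
proof -
  assume v: "v \<in> E i"
  have "ce l (S v) = 0" if l: "l \<in> {1..m}" "l < i + 1" for l
  proof (cases "l = 1")
    case False
    then have "l - 1 \<in> {1..m}" "l - 1 < i" using l by auto
    then show ?thesis using v l by (simp add: ce_S E_def)
  qed (use l in \<open>simp add: ce_S\<close>)
  then show ?thesis by (auto simp: E_def S_N cf_S)
qed
lemma S_M_E: "v \<in> M \<Longrightarrow> S v \<in> E 3"
proof -
  assume v: "v \<in> M"
  have "ce l (S v) = 0" if "l \<in> {1..m}" "l < 3" for l
  proof (cases "l = 1")
    case False
    then have "l - 1 = 1" using that by auto
    then show ?thesis using that False v by (simp add: ce_S M_ce1)
  qed (use that in \<open>simp add: ce_S\<close>)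
  then show ?thesis by (auto simp: E_def S_N cf_S)
qed
lemma E_last: "v \<in> E (m + 1) \<Longrightarrow> v = 0"
  by (rule N_eqI) (auto simp: E_def N_closed c_simps)
lemma E_step: "i \<in> {1..m} \<Longrightarrow> v \<in> E i \<Longrightarrow> v - scale (ce i v) (e i) \<in> E (i + 1)"
  by (auto simp: E_def N_closed e_N c_simps ce_e cf_e less_Suc_eq)
lemma e_E: "i \<in> {1..m} \<Longrightarrow> e i \<in> E i"
  by (auto simp: E_def e_N ce_e cf_e)

lemma M_decomp_E: "v \<in> M \<Longrightarrow> \<exists>u\<in>E 2. v - u \<in> G"
proof -
  assume v: "v \<in> M"
  define u where "u = (\<Sum>i = 2..m. scale (ce i v) (e i))"
  have "u \<in> E 2" unfolding u_def by (intro E_closed E_mono[OF _ e_E]) auto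
  moreover have "v - u = (\<Sum>j = k+1..2*k. scale (cf j v) (f j))"
    using M_expand[OF v] by (simp add: u_def algebra_simps)
  then have "v - u \<in> G" by (simp only:) (intro G_closed f_G)
  ultimately show ?thesis by blast
qed

context
  fixes x h
  assumes ad: "adapted x h"
begin

lemma adapted_right_mult_e2: "bracket (e 2) x - e 2 - J h \<in> E 3"
proof -
  have "bracket (e 2) x - e 2 - J h = S (bracket (e 1) x - h)"
    unfolding right_mult_e2 adapted_psi_e1[OF ad] adapted_J_right_mult_e1[OF ad] adapted_S_right_mult_e1[OF ad] by simp
  then show ?thesis using adapted_props[OF ad] by (simp add: S_M_E)
qed

lemma adapted_right_mult_S: "v \<in> N \<Longrightarrow> ce 1 v = 0 \<Longrightarrow> bracket (S v) x = S (bracket v x) + S v"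
  by (simp add: right_mult_S adapted_psi_e1[OF ad])

text \<open>Applying \<open>S\<close> raises the eigenvalue by $1$ and moves the error one step down the filtration. For
  $i = 2$ there is still the term \<open>J h\<close>, which \<open>S\<close> kills.\<close>

lemma adapted_right_mult_e: "3 \<le> i \<Longrightarrow> i \<le> m \<Longrightarrow> bracket (e i) x - scale (of_nat (i - 1)) (e i) \<in> E (i + 1)"
proof (induction i rule: dec_induct)
  case base
  have "bracket (e 3) x - scale 2 (e 3) = S (bracket (e 2) x - e 2 - J h)"
    using adapted_right_mult_S[of "e 2"]
    by (simp add: e2_N M_ce1 e2_M Se2 SJ_simps S_K[OF G_K[OF J_G]] scale_left_distrib[of 1 1, simplified])
  then show ?case using S_E[OF adapted_right_mult_e2] by simp
next
  case (step i)
  have i: "i \<in> {1..m}" "i < m" "i \<in> {2..m}" using step by auto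
  have Se: "S (e i) = e (Suc i)" using S_e[of i] i by (simp flip: Suc_eq_plus1)
  have "bracket (e (Suc i)) x = S (bracket (e i) x) + e (Suc i)"
    using adapted_right_mult_S[of "e i"] i e_M[of i] by (simp add: e_N M_ce1 Se)
  moreover have "scale (of_nat i) (e (Suc i)) = scale (of_nat (i - 1)) (e (Suc i)) + e (Suc i)"
    using i by (cases i) (simp_all add: scale_left_distrib add.commute)
  ultimately have "bracket (e (Suc i)) x - scale (of_nat i) (e (Suc i))
      = S (bracket (e i) x - scale (of_nat (i - 1)) (e i))"
    by (simp add: SJ_simps Se)
  moreover have "S (bracket (e i) x - scale (of_nat (i - 1)) (e i)) \<in> E (i + 1 + 1)"
    by (rule S_E) (use step in auto)
  ultimately show ?case by (simp flip: Suc_eq_plus1)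
qed

lemma adapted_right_mult_em: "bracket (e m) x = scale (of_nat (m - 1)) (e m)"
  using E_last[OF adapted_right_mult_e[of m]] m4 by simp

text \<open>Back substitution from $e_m$ upwards; the eigenvalue $i - 1$ at $e_i$ is nonzero since $i \ge 2$.\<close>

lemma adapted_onto_E_mod_G: "2 \<le> i \<Longrightarrow> i \<le> m + 1 \<Longrightarrow> v \<in> E i \<Longrightarrow> \<exists>\<xi>\<in>E i. bracket \<xi> x - v \<in> G"
proof (induction "m + 1 - i" arbitrary: i v)
  case 0
  then have "v = 0" using E_last[of v] by (cases "i = m + 1") auto
  then show ?case by (intro bexI[of _ 0]) (auto simp: bracket_simps G_closed E_closed)
next
  case (Suc n)
  have i: "i \<in> {1..m}" "2 \<le> i" using Suc by auto
  have nm: "n = m + 1 - (i + 1)" using Suc(2) by arith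
  define c where "c = ce i v / of_nat (i - 1)"
  have cc: "scale (ce i v) (e i) = scale c (scale (of_nat (i - 1)) (e i))"
    using i by (simp add: c_def)
  have r: "\<exists>g\<in>G. bracket (e i) x - scale (of_nat (i - 1)) (e i) - g \<in> E (i + 1)"
  proof (cases "i = 2")
    case True
    then show ?thesis using adapted_right_mult_e2 J_G by (intro bexI[of _ "J h"]) simp_all
  next
    case False
    then show ?thesis using adapted_right_mult_e[of i] i by (intro bexI[of _ 0]) (auto simp: G_closed)
  qed
  then obtain g where g: "g \<in> G" and r: "bracket (e i) x - scale (of_nat (i - 1)) (e i) - g \<in> E (i + 1)"
    by blast
  define q where "q = bracket (e i) x - scale (of_nat (i - 1)) (e i) - g"
  have "v - scale (ce i v) (e i) - scale c q \<in> E (i + 1)"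
    unfolding q_def by (rule E_closed(2)[OF E_step[OF i(1) Suc(5)] E_closed(4)[OF r]])
  then obtain \<xi> where \<xi>: "\<xi> \<in> E (i + 1)"
      and D: "bracket \<xi> x - (v - scale (ce i v) (e i) - scale c q) \<in> G"
    using Suc(1)[of "i + 1"] i nm by auto
  have "scale c (e i) + \<xi> \<in> E i"
    using i \<xi> by (intro E_closed e_E) (auto intro: E_mono[of _ "i + 1"])
  moreover have "bracket (scale c (e i) + \<xi>) x - v
      = (bracket \<xi> x - (v - scale (ce i v) (e i) - scale c q)) + scale c g"
    unfolding cc by (simp add: bracket_simps q_def algebra_simps del: scale_scale)
  then have "bracket (scale c (e i) + \<xi>) x - v \<in> G"
    using D g by (simp only: G_closed)
  ultimately show ?case by blast
qed

lemma adapted_onto_M_mod_G: assumes v: "v \<in> M" obtains \<xi> where "\<xi> \<in> M" "bracket \<xi> x - v \<in> G"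
proof -
  obtain u where u: "u \<in> E 2" "v - u \<in> G" using M_decomp_E[OF v] by blast
  obtain \<xi> where \<xi>: "\<xi> \<in> E 2" "bracket \<xi> x - u \<in> G" using adapted_onto_E_mod_G[of 2 u] m4 u by auto
  have "bracket \<xi> x - v = (bracket \<xi> x - u) - (v - u)" by simp
  then have "bracket \<xi> x - v \<in> G" using u \<xi> by (simp only: G_closed)
  then show ?thesis using \<xi> that E_M by blast
qed

end

section \<open>Normalising an adapted pair\<close>

text \<open>The vector $e_m$ is an eigenvector of $T$ with eigenvalue $m - 2 \ne 0$, so the component of
  $T^k h$ at $e_m$ can be cancelled by a multiple of $e_m$ in $h$.\<close>

lemma normalise_em_component:
  assumes ad: "adapted x h"
  obtains h' where "adapted x h'" "(T x ^^ k) h' \<in> G"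
proof -
  define p where "p = ce m ((T x ^^ k) h)"
  define a :: complex where "a = of_nat (m - 2)"
  have a0: "a \<noteq> 0" unfolding a_def of_nat_eq_0_iff using m4 by simp
  define \<eta> where "\<eta> = - (p / a ^ k)"
  have TM: "(T x ^^ k) h \<in> M" and TK: "(T x ^^ k) h \<in> K"
    using adapted_props[OF ad] by (auto intro: T_pow_K)
  have em: "scale \<eta> (e m) \<in> K" "scale \<eta> (e m) \<in> M" by (auto intro: K_closed M_closed em_K em_M)
  have ad': "adapted x (h + scale \<eta> (e m))"
    using adapted_change[OF ad N_closed(7) _ em] by (simp add: psi_simps)
  have "of_nat (m - 1) - 1 = a" using m4 by (simp add: a_def of_nat_diff)
  then have "(T x ^^ k) (e m) = scale (a ^ k) (e m)"
    using T_pow_eigenvector[OF adapted_right_mult_em[OF ad], of k] by simp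
  then have "(T x ^^ k) (h + scale \<eta> (e m)) = (T x ^^ k) h - scale p (e m)"
    using a0 by (simp add: T_pow_simps \<eta>_def)
  then have "(T x ^^ k) (h + scale \<eta> (e m)) \<in> G"
    using M_Int_K_decomp[OF TM TK] by (simp add: p_def)
  with ad' show ?thesis by (rule that)
qed

text \<open>Left multiplication of $e_1$ by $y$ is $S y$, and \<open>S\<close> reaches all of $e_2,\dots,e_m$. Reaching $e_2$
  requires $e_1$, whose effect on \<open>psi\<close> is balanced by $f_1$, which \<open>S\<close> kills.\<close>

lemma normalise_left_mult_e1:
  assumes ad: "adapted x h" and G: "(T x ^^ k) h \<in> G"
  obtains y where "y \<in> N" "adapted (x + y) h" "(T (x + y) ^^ k) h \<in> G" "bracket (x + y) (e 1) + h \<in> G"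
proof -
  define v where "v = bracket x (e 1) + h"
  have "v = Z x (e 1) - (bracket (e 1) x - h)" by (simp add: v_def Z_def)
  also have "\<dots> \<in> M" by (rule M_closed(2)[OF Z_M[OF e1_N] adapted_props(3)[OF ad]])
  finally have v: "v \<in> M" .
  define y where "y = scale (ce 2 v) (f 1) - (\<Sum>i = 2..m. scale (ce i v) (e (i - 1)))"
  have y: "y \<in> N" unfolding y_def by (intro N_closed f1_N e_N) auto
  have ce1_pred: "ce 1 (e (i - 1)) = (if i = 2 then 1 else 0)" if "i \<in> {2..m}" for i
  proof -
    have "i - 1 \<in> {1..m}" "1 \<in> {1..m}" "i - 1 = 1 \<longleftrightarrow> i = 2" using that by auto
    then show ?thesis by (simp add: ce_e)
  qed
  have ce1_sum: "ce 1 (\<Sum>i = 2..m. scale (ce i v) (e (i - 1))) = ce 2 v"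
  proof -
    have "ce 1 (\<Sum>i = 2..m. scale (ce i v) (e (i - 1))) = (\<Sum>i = 2..m. if i = 2 then ce 2 v else 0)"
      unfolding c_sums by (intro sum.cong) (auto simp: c_simps ce1_pred)
    then show ?thesis using m4 by simp
  qed
  have cf1_sum: "cf 1 (\<Sum>i = 2..m. scale (ce i v) (e (i - 1))) = 0"
  proof -
    have "cf 1 (e (i - 1)) = 0" if "i \<in> {2..m}" for i
      using that k2 by (intro cf_e) auto
    then show ?thesis unfolding c_sums by (intro sum.neutral) (simp add: c_simps)
  qed
  have psi: "psi y = 0"
    by (simp add: y_def psi_simps psi_f1) (simp add: psi_def ce1_sum cf1_sum)
  have Sy: "S y = - (\<Sum>i = 2..m. scale (ce i v) (e i))"
  proof -
    have "S (\<Sum>i = 2..m. scale (ce i v) (e (i - 1))) = (\<Sum>i = 2..m. scale (ce i v) (e i))"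
    proof -
      have "S (e (i - 1)) = e i" if "i \<in> {2..m}" for i
      proof -
        have i: "i - 1 \<in> {1..m}" "i - 1 < m" "i - 1 + 1 = i" using that by auto
        show ?thesis using S_e[OF i(1)] unfolding i(3) using i(2) by (simp only: if_True)
      qed
      then show ?thesis unfolding SJ_sums by (intro sum.cong) (simp_all add: SJ_simps)
    qed
    then show ?thesis by (simp add: y_def SJ_simps S_K f1_K)
  qed
  have "bracket (x + y) (e 1) + h = v + S y"
    by (simp add: v_def bracket_simps bracket_right_e1 y)
  also have "\<dots> = (\<Sum>j = k+1..2*k. scale (cf j v) (f j))"
    unfolding Sy by (subst (1) M_expand[OF v]) simp
  also have "\<dots> \<in> G" by (intro G_closed f_G) auto
  finally have L: "bracket (x + y) (e 1) + h \<in> G" .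
  have "adapted (x + y) h"
    using adapted_change[OF ad y psi K_closed(5) M_closed(5)] by simp
  moreover have "(T (x + y) ^^ k) h \<in> G"
    using G by (simp add: T_pow_add_K y psi adapted_props[OF ad])
  ultimately show ?thesis using that y L by blast
qed

text \<open>
  Consequences of the Leibniz identity for $x, v, x$ once $[x,e_1] = -h + t$ with \<open>t \<in> G\<close>. The
  remaining unknown is the multiple of $e_m$ in $S[x,x]$, which propagates along the chain $T^j h$ with
  nonzero factors and so is forced to vanish at its end.
\<close>

context
  fixes x h t
  assumes ad: "adapted x h" and TG: "(T x ^^ k) h \<in> G"
    and t_def: "t = bracket x (e 1) + h" and tG: "t \<in> G"
begin

lemma S_left_mult_e1_zero: "S (bracket x (e 1)) = 0"
proof -
  have "bracket x (e 1) = t - h" by (simp add: t_def)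
  then show ?thesis using tG adapted_props[OF ad] by (simp add: SJ_simps S_K G_K)
qed

lemma S_Z_K: "v \<in> K \<Longrightarrow> Z x v \<in> K"
  using S_zero_K[OF M_N[OF Z_M[OF K_N]]] by (simp add: S_Z S_left_mult_e1_zero)

lemma square_in_M: "bracket x x \<in> M"
proof (rule right_annihilated_M)
  show "bracket x x \<in> N" by (rule adapted_props[OF ad])
qed (rule bracket_square_right)

lemma Z_h: "Z x h = bracket t x - S (bracket x x)"
proof -
  have "bracket x (bracket (e 1) x) = bracket (bracket x (e 1)) x - bracket (bracket x x) (e 1)"
    by (rule leibniz_identity)
  moreover have "bracket x (bracket (e 1) x) = bracket x h"
    using bracket_M_right[OF adapted_props(3)[OF ad], of x] by (simp add: bracket_simps)
  moreover have "bracket x (e 1) = t - h" by (simp add: t_def)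
  ultimately show ?thesis
    using adapted_props[OF ad] by (simp add: Z_def bracket_simps bracket_right_e1 algebra_simps)
qed

lemma S_square_multiple_em: "S (bracket x x) = scale (ce m (S (bracket x x))) (e m)"
proof (rule S_in_K)
  have "S (bracket x x) = bracket t x - Z x h" by (simp add: Z_h)
  also have "\<dots> \<in> K" by (rule K_closed(2)[OF K_invariant[OF G_K[OF tG]] S_Z_K[OF adapted_props(1)[OF ad]]])
  finally show "S (bracket x x) \<in> K" .
qed

lemma Z_T: "v \<in> K \<Longrightarrow> Z x (T x v) = T x (Z x v) - scale (cf 1 v) (S (bracket x x))"
  by (simp add: T_def Z_simps Z_right_mult bracket_M_left[OF square_in_M] K_N K_psi)

text \<open>The vectors $T^{j+1} h$ have $f_1$-coordinate $0$, so after the first step $Z$ commutes with $T$ on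
  the chain, and the term at $e_m$ is multiplied by the eigenvalue $m - 2$ of $T$.\<close>

lemma Z_T_pow: "Z x ((T x ^^ Suc j) h) = (T x ^^ Suc j) (bracket t x)
    - scale (of_nat (m - 1) * of_nat (m - 2) ^ j * ce m (S (bracket x x))) (e m)"
proof (induction j)
  case 0
  define \<omega> where "\<omega> = ce m (S (bracket x x))"
  have s: "S (bracket x x) = scale \<omega> (e m)" using S_square_multiple_em by (simp add: \<omega>_def)
  have Tem: "T x (e m) = scale (of_nat (m - 1)) (e m) - e m" by (simp add: T_def adapted_right_mult_em[OF ad])
  then show ?case
    using adapted_props[OF ad] unfolding \<omega>_def[symmetric]
    by (simp add: Z_T Z_h s T_simps Tem algebra_simps)
next
  case (Suc j)
  define c where "c = of_nat (m - 1) * of_nat (m - 2) ^ j * ce m (S (bracket x x))"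
  have "(of_nat (m - 1) :: complex) - 1 = of_nat (m - 2)" using m4 by (simp add: of_nat_diff)
  then have Tem: "T x (e m) = scale (of_nat (m - 2)) (e m)"
    using T_pow_eigenvector[OF adapted_right_mult_em[OF ad], of "Suc 0"] by simp
  have "Z x ((T x ^^ Suc (Suc j)) h) = T x (Z x ((T x ^^ Suc j) h))"
    using Z_T[OF T_pow_K[OF adapted_props(1)[OF ad], where x = x and j = "Suc j"]] adapted_cf1_T_pow[OF ad, of "Suc j"] by simp
  also have "\<dots> = (T x ^^ Suc (Suc j)) (bracket t x) - scale (c * of_nat (m - 2)) (e m)"
    unfolding Suc c_def[symmetric] by (simp add: T_simps Tem)
  finally show ?case by (simp add: c_def mult_ac)
qed

text \<open>At $j + 1 = k$ the vector $T^k h$ lies in \<open>G\<close>, where $Z = D$ and no $e_m$ occurs, and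
  $T^k D t = 0$. Comparing components at $e_m$ and in \<open>G\<close> gives both claims.\<close>

lemma S_square_zero: "S (bracket x x) = 0" and right_mult_T_pow_h_zero: "bracket ((T x ^^ k) h) x = 0"
proof -
  have k: "Suc (k - 1) = k" using k2 by simp
  have eq: "bracket ((T x ^^ k) h) x
    = - scale (of_nat (m - 1) * of_nat (m - 2) ^ (k - 1) * ce m (S (bracket x x))) (e m)"
    using Z_T_pow[of "k - 1"] TG tG
    unfolding k by (simp add: Z_on_M G_M T_pow_bracket adapted_right_mult_T_pow_G_zero[OF ad])
  have "ce m (bracket ((T x ^^ k) h) x) = 0"
    using adapted_G_invariant[OF ad TG] m4 by (simp add: G_def)
  then have "of_nat (m - 1) * of_nat (m - 2) ^ (k - 1) * ce m (S (bracket x x)) = 0"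
    using m4 unfolding eq by (simp add: c_simps ce_e)
  moreover have "(of_nat (m - 1) :: complex) \<noteq> 0" "(of_nat (m - 2) :: complex) \<noteq> 0"
    unfolding of_nat_eq_0_iff using m4 by simp_all
  ultimately have "ce m (S (bracket x x)) = 0" by (simp del: of_nat_diff)
  then show "S (bracket x x) = 0" "bracket ((T x ^^ k) h) x = 0"
    using S_square_multiple_em eq by simp_all
qed

lemma Z_T_pow_h: "Z x ((T x ^^ j) h) = (T x ^^ j) (bracket t x)"
  by (cases j) (use Z_T_pow in \<open>simp_all add: Z_h S_square_zero c_simps\<close>)

end

text \<open>Add $v \in G$ to $h$. Let $b = T^k h$, which lies in $\ker D$, and $r = T^k t$, also in $\ker D$. On
  $\ker D$ the operator $T$ is $-1$. The summand $-(-1)^k b$ of $v$ therefore cancels $b$ in $T^k h$,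
  and $(-1)^k r - t$ replaces $t$ by its component $(-1)^k r$ in $\ker D$ while contributing $0$ to
  $T^k h$.\<close>

lemma normalise_chain:
  assumes ad: "adapted x h" and TG: "(T x ^^ k) h \<in> G" and tG: "bracket x (e 1) + h \<in> G"
  obtains h' where "adapted x h'" "(T x ^^ k) h' = 0" "bracket x (e 1) + h' \<in> G"
    "bracket (bracket x (e 1) + h') x = 0" "\<And>j. Z x ((T x ^^ j) h') = 0" "S (bracket x x) = 0"
proof -
  define t b where "t = bracket x (e 1) + h" and "b = (T x ^^ k) h"
  have t: "t \<in> G" and b: "b \<in> G" using assms by (simp_all add: t_def b_def)
  note facts = ad TG t_def t
  have Db: "bracket b x = 0" unfolding b_def by (rule right_mult_T_pow_h_zero[OF facts])
  define r where "r = (T x ^^ k) t"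
  have r: "r \<in> G" unfolding r_def by (rule T_pow_closed[OF adapted_G_invariant[OF ad] G_subspace t])
  have Dr: "bracket r x = 0" unfolding r_def by (rule adapted_right_mult_T_pow_G_zero[OF ad t])
  have kernel: "(T x ^^ k) u = scale ((- 1) ^ k) u" if "bracket u x = 0" for u
    using T_pow_eigenvector[of u x 0 k] that by simp
  define v where "v = scale ((- 1) ^ k) r - scale ((- 1) ^ k) b - t"
  have v: "v \<in> G" unfolding v_def using r b t by (intro G_closed)
  have sq: "(- 1 :: complex) ^ k * (- 1) ^ k = 1" by (simp add: power_mult_distrib[symmetric])
  have tv: "t + v = scale ((- 1) ^ k) r - scale ((- 1) ^ k) b" by (simp add: v_def)
  have "adapted x (h + v)"
    using adapted_change[OF ad N_closed(7) _ G_K[OF v] G_M[OF v]] by (simp add: psi_simps)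
  moreover have "(T x ^^ k) (h + v) = 0"
    by (simp add: v_def T_pow_simps kernel Db Dr sq flip: b_def r_def)
  moreover have tv': "bracket x (e 1) + (h + v) = t + v" by (simp add: t_def)
  then have "bracket x (e 1) + (h + v) \<in> G" using t v by (simp only: G_closed)
  moreover have D: "bracket (t + v) x = 0" unfolding tv by (simp add: bracket_simps Db Dr)
  then have "bracket (bracket x (e 1) + (h + v)) x = 0" by (simp only: tv')
  moreover have "Z x ((T x ^^ j) (h + v)) = 0" for j
  proof -
    have "Z x ((T x ^^ j) (h + v)) = (T x ^^ j) (bracket t x) + bracket ((T x ^^ j) v) x"
      by (simp add: T_pow_simps Z_simps Z_T_pow_h[OF facts] Z_on_M T_pow_M G_M v)
    also have "\<dots> = (T x ^^ j) (bracket (t + v) x)"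
      by (simp add: bracket_simps T_pow_simps T_pow_bracket)
    finally show ?thesis by (simp add: D T_pow_simps)
  qed
  moreover have "S (bracket x x) = 0" by (rule S_square_zero[OF facts])
  ultimately show ?thesis by (rule that)
qed

text \<open>\<open>\<xi>\<close> corrects $e_1$. The fourth condition makes $[x,e_1] + h$ a multiple of the alternating sum in
  \<open>adapted_G_kernel\<close>; its coefficient is the third parameter of the table.\<close>

definition normal_form :: "'a \<Rightarrow> 'a \<Rightarrow> 'a \<Rightarrow> complex \<Rightarrow> complex \<Rightarrow> bool" where
  "normal_form x h \<xi> \<alpha> \<gamma> \<longleftrightarrow> adapted x h \<and> (T x ^^ k) h = 0 \<and>
     bracket x (e 1) + h \<in> G \<and> bracket (bracket x (e 1) + h) x = 0 \<and>
     (\<forall>j. Z x ((T x ^^ j) h) = 0) \<and> \<xi> \<in> M \<and>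
     bracket (e 1 + \<xi>) x = h + scale \<alpha> (J h) \<and> bracket x x = scale \<gamma> (J h)"

text \<open>First choose $\xi$, then split the remaining error in \<open>G\<close> by \<open>adapted_G_decomp\<close>. The change of $x$ is by an
  element of \<open>K\<close>, so left multiplication by $x$ on $N$ does not change. Its summand in \<open>K \<inter> M\<close> corrects
  $[x,x]$ and affects no other product.\<close>

lemma normalise_x:
  assumes ad: "adapted x h" and Tk: "(T x ^^ k) h = 0" and tG: "bracket x (e 1) + h \<in> G"
    and Dt: "bracket (bracket x (e 1) + h) x = 0" and Z0: "\<And>j. Z x ((T x ^^ j) h) = 0"
    and Sxx: "S (bracket x x) = 0"
  obtains y \<xi> \<alpha> \<gamma> where "y \<in> N" "normal_form (x + y) h \<xi> \<alpha> \<gamma>"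
proof -
  have h: "h \<in> K" by (rule adapted_props[OF ad])
  obtain \<xi> where \<xi>: "\<xi> \<in> M" and D\<xi>: "bracket \<xi> x - (h - bracket (e 1) x) \<in> G"
    using adapted_onto_M_mod_G[OF ad, of "h - bracket (e 1) x"] M_closed(3)[OF adapted_props(3)[OF ad]] by auto
  define g where "g = bracket (e 1 + \<xi>) x - h"
  have "g \<in> G" using D\<xi> by (simp add: g_def bracket_simps algebra_simps)
  then obtain \<alpha> y1 u1 where y1: "y1 \<in> K" "cf 1 y1 = 0" and g: "g = scale \<alpha> (J h) + J y1"
    using adapted_G_decomp[OF ad] by metis
  define w where "w = bracket x x - Z x y1"
  have wM: "w \<in> M" unfolding w_def
    by (rule M_closed(2)[OF right_annihilated_M[OF adapted_props(5)[OF ad] bracket_square_right]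
          Z_M[OF K_N[OF y1(1)]]])
  have wK: "w \<in> K"
    by (rule S_zero_K[OF M_N[OF wM]]) (simp add: w_def SJ_simps Sxx S_Z y1)
  define \<rho> where "\<rho> = ce m w"
  obtain \<gamma> y2 u2 where u2: "u2 \<in> G" and w: "w - scale \<rho> (e m) = scale \<gamma> (J h) + bracket u2 x"
    using adapted_G_decomp[OF ad M_Int_K_decomp[OF wM wK]] unfolding \<rho>_def by metis
  define y3 where "y3 = - scale (\<rho> / of_nat (m - 1)) (e m) - u2"
  have y3: "y3 \<in> K" "y3 \<in> M"
    unfolding y3_def
    by (rule K_closed(2)[OF K_closed(3)[OF K_closed(4)[OF em_K]] G_K[OF u2]],
        rule M_closed(2)[OF M_closed(3)[OF M_closed(4)[OF em_M]] G_M[OF u2]])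
  define y where "y = y3 - y1"
  have yK: "y \<in> K" unfolding y_def using y1 y3 by (intro K_closed)
  have yN: "y \<in> N" by (rule K_N[OF yK])
  \<comment> \<open>\<open>y1\<close> repairs $[e_1 + \xi, x]$ and \<open>y3\<close> repairs $[x,x]$ after the change by \<open>- y1\<close>.\<close>
  have psiy: "psi y = 0" using y1 y3 by (simp add: y_def psi_simps M_psi K_psi)
  have Jy: "J y = - J y1" using y3 by (simp add: y_def SJ_simps J_M)
  have ad': "adapted (x + y) h"
    using adapted_change[OF ad yN psiy K_closed(5) M_closed(5)] by simp
  have L: "bracket (x + y) v = bracket x v" if "v \<in> N" for v
    using that yK by (simp add: bracket_simps bracket_K_left)
  have DK: "bracket v (x + y) = bracket v x" if "v \<in> K" for v
    using that by (simp add: bracket_add_K yN psiy)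
  have Zeq: "Z (x + y) v = Z x v" if "v \<in> K" for v
    using that by (simp add: Z_def L DK K_N)
  have Tpow: "(T (x + y) ^^ j) h = (T x ^^ j) h" for j
    using h by (simp add: T_pow_add_K yN psiy)
  have e1\<xi>: "bracket (e 1 + \<xi>) (x + y) = h + scale \<alpha> (J h)"
  proof -
    have "bracket (e 1 + \<xi>) (x + y) = bracket (e 1 + \<xi>) x + J y"
      using \<xi> by (simp add: bracket_add_psi0 yN psiy N_closed e1_N M_N c_simps ce1_e1 M_ce1)
    also have "\<dots> = h + (g + J y)" by (simp add: g_def)
    finally show ?thesis by (simp add: g Jy)
  qed
  have "bracket (x + y) (x + y) = bracket x x + Z x y"
    using yK by (simp add: Z_def bracket_simps bracket_K_left yN)
  also have "Z x y = bracket y3 x - Z x y1"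
    using y3 by (simp add: y_def Z_simps Z_on_M)
  also have "bracket y3 x = - scale \<rho> (e m) - bracket u2 x"
    using m4 by (simp add: y3_def bracket_simps adapted_right_mult_em[OF ad])
  also have "bracket x x + (- scale \<rho> (e m) - bracket u2 x - Z x y1) = scale \<gamma> (J h)"
    using w by (simp add: w_def algebra_simps)
  finally have xx: "bracket (x + y) (x + y) = scale \<gamma> (J h)" .
  have "normal_form (x + y) h \<xi> \<alpha> \<gamma>"
    unfolding normal_form_def using ad' Tk tG Dt Z0 \<xi> e1\<xi> xx h
    by (simp add: Tpow L e1_N DK G_K Zeq T_pow_K)
  with yN show ?thesis by (rule that)
qed

lemma normal_form_exists:
  assumes "adapted x h"
  obtains y h' \<xi> \<alpha> \<gamma> where "y \<in> N" "normal_form (x + y) h' \<xi> \<alpha> \<gamma>"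
proof -
  obtain h1 where 1: "adapted x h1" "(T x ^^ k) h1 \<in> G" using normalise_em_component[OF assms] .
  obtain y1 where y1: "y1 \<in> N" and 2: "adapted (x + y1) h1" "(T (x + y1) ^^ k) h1 \<in> G"
      "bracket (x + y1) (e 1) + h1 \<in> G"
    using normalise_left_mult_e1[OF 1] .
  obtain h2 where 3: "adapted (x + y1) h2" "(T (x + y1) ^^ k) h2 = 0" "bracket (x + y1) (e 1) + h2 \<in> G"
    "bracket (bracket (x + y1) (e 1) + h2) (x + y1) = 0"
    "\<And>j. Z (x + y1) ((T (x + y1) ^^ j) h2) = 0" "S (bracket (x + y1) (x + y1)) = 0"
    using normalise_chain[OF 2] by blast
  obtain y2 \<xi> \<alpha> \<gamma> where y2: "y2 \<in> N" and 4: "normal_form (x + y1 + y2) h2 \<xi> \<alpha> \<gamma>"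
    using normalise_x[OF 3] by blast
  show ?thesis using that[of "y1 + y2" h2 \<xi> \<alpha> \<gamma>] y1 y2 4 by (simp add: N_closed add.assoc)
qed

end

section \<open>Spanning lists and cyclic vectors of a Jordan block\<close>

context vector_space
begin

text \<open>A shorter spanning set would contradict the dimension, whether it arises from a repetition or from
  a linear relation.\<close>

lemma spanning_list_basis:
  assumes span: "span (set vs) = UNIV" and dim: "length vs = dim UNIV"
  shows "distinct vs" "independent (set vs)"
proof -
  have "dim UNIV \<le> card (set vs)" by (rule dim_le_card) (simp_all add: span)
  then have card: "card (set vs) = length vs" using dim card_length[of vs] by simp
  then show "distinct vs" by (simp add: card_distinct)
  show "independent (set vs)"
  proof
    assume "dependent (set vs)"
    then obtain a where a: "a \<in> set vs" "a \<in> span (set vs - {a})" by (auto simp: dependent_def)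
    have "set vs \<subseteq> span (set vs - {a})"
    proof
      fix b assume "b \<in> set vs"
      then show "b \<in> span (set vs - {a})" using a by (cases "b = a") (auto intro: span_base)
    qed
    then have "UNIV \<subseteq> span (set vs - {a})" using span span_minimal[OF _ subspace_span] by metis
    then have "dim UNIV \<le> card (set vs - {a})" by (rule dim_le_card) simp
    then show False using a dim card by (metis List.finite_set card_Diff1_less not_less)
  qed
qed

lemma span_image_lessThan:
  assumes "v \<in> span (b ` {..<n :: nat})"
  obtains c where "v = (\<Sum>j<n. scale (c j) (b j))"
proof -
  have "\<exists>c. v = (\<Sum>j<n. scale (c j) (b j))"
    using assms
  proof (induction rule: span_induct_alt)
    case base
    show ?case by (rule exI[of _ "\<lambda>_. 0"]) simp
  next
    case (step a w u)
    then obtain i c where i: "i < n" "w = b i" and c: "u = (\<Sum>j<n. scale (c j) (b j))" by auto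
    have "(\<Sum>j<n. scale (if j = i then a else 0) (b j)) = (\<Sum>j<n. if j = i then scale a (b i) else 0)"
      by (intro sum.cong) auto
    then have "scale a w + u = (\<Sum>j<n. scale ((if j = i then a else 0) + c j) (b j))"
      using i by (simp add: c scale_left_distrib sum.distrib)
    then show ?case by (rule exI[of _ "\<lambda>j. (if j = i then a else 0) + c j"])
  qed
  then show ?thesis using that by blast
qed

text \<open>The $p$-th power of $U$ moves the top vector $g_{n-1}$ of the chain to a nonzero multiple of
  $g_{n-1-p}$ and the lower ones further down. Hence the vectors $U^p h$ are triangular with respect to
  the chain, read from the bottom.\<close>

lemma jordan_chain_cyclic:
  assumes U: "module_hom scale scale U" and U0: "U (g 0) = 0"
    and US: "\<And>j. Suc j < n \<Longrightarrow> U (g (Suc j)) = scale c (g j)" and c: "c \<noteq> 0"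
    and h: "h = (\<Sum>i<n. scale (a i) (g i))" and n: "n > 0" and top: "a (n - 1) \<noteq> 0"
  shows "(U ^^ n) h = 0" and "\<And>i. i < n \<Longrightarrow> g i \<in> span ((\<lambda>j. (U ^^ j) h) ` {..<n})"
proof -
  interpret U: module_hom scale scale U by (rule U)
  have pow: "(U ^^ j) (g i) = (if j \<le> i then scale (c ^ j) (g (i - j)) else 0)" if "i < n" for i j
  proof (induction j)
    case (Suc j)
    show ?case
    proof (cases "Suc j \<le> i")
      case True
      then have eq: "i - j = Suc (i - Suc j)" by simp
      show ?thesis using Suc True US[of "i - Suc j"] that by (simp add: U.scale eq mult.commute)
    next
      case False
      then show ?thesis using Suc U0 by (cases "j = i") (simp_all add: U.scale)
    qed
  qed simp
  have pow_sum: "(U ^^ j) h = (\<Sum>i<n. scale (a i) ((U ^^ j) (g i)))" for j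
    unfolding h by (induction j) (simp_all add: U.sum U.scale)
  show "(U ^^ n) h = 0" unfolding pow_sum by (intro sum.neutral) (simp add: pow)
  let ?W = "span ((\<lambda>j. (U ^^ j) h) ` {..<n})"
  show "g i \<in> ?W" if "i < n" for i
    using that
  proof (induction i rule: less_induct)
    case (less i)
    \<comment> \<open>The power that carries the top vector of the chain to \<open>g i\<close>.\<close>
    define p where "p = n - 1 - i"
    have p: "p < n" "n - 1 - p = i" "p \<le> n - 1" using less by (auto simp: p_def)
    have split: "{..<n} = insert (n - 1) {..<n - 1}" using n by auto
    have "(U ^^ p) h = scale (a (n - 1)) (scale (c ^ p) (g i))
        + (\<Sum>l<n - 1. scale (a l) ((U ^^ p) (g l)))"
      unfolding pow_sum split using n p by (simp add: pow)
    then have "scale (a (n - 1) * c ^ p) (g i)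
        = (U ^^ p) h - (\<Sum>l<n - 1. scale (a l) ((U ^^ p) (g l)))" by simp
    also have "\<dots> \<in> ?W"
    proof (intro span_diff span_sum span_scale)
      show "(U ^^ p) h \<in> ?W" using p by (intro span_base) auto
      fix l assume "l \<in> {..<n - 1}"
      then have l: "l < n - 1" "l < n" by auto
      show "(U ^^ p) (g l) \<in> ?W"
      proof (cases "p \<le> l")
        case True
        have "g (l - p) \<in> ?W" using l p less.prems True by (intro less.IH) auto
        then show ?thesis using l True by (simp add: pow span_scale)
      qed (use l in \<open>simp add: pow span_zero\<close>)
    qed
    finally have "scale (inverse (a (n - 1) * c ^ p)) (scale (a (n - 1) * c ^ p) (g i)) \<in> ?W"
      by (rule span_scale)
    moreover have "inverse (a (n - 1) * c ^ p) * (a (n - 1) * c ^ p) = 1"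
      using top c by (intro Fields.left_inverse) simp
    ultimately show ?case by (simp only: scale_scale scale_one)
  qed
qed

end

section \<open>The Jordan block yields an adapted pair\<close>

context mu2_in_leibniz
begin

definition P :: "'a \<Rightarrow> 'a" where
  "P v = (\<Sum>j = 1..k. scale (cf j v) (f j))"

lemma P_hom: "module_hom scale scale P"
  unfolding P_def
  by unfold_locales (simp_all add: c_simps algebra_simps sum.distrib scale_sum_right)

lemma P_F: "P v \<in> span (f ` {1..k})"
  unfolding P_def by (intro span_sum span_scale span_base) auto

lemma cf_P: "j \<in> {1..k} \<Longrightarrow> cf j (P v) = cf j v"
proof -
  assume j: "j \<in> {1..k}"
  have "cf j (P v) = (\<Sum>i = 1..k. if i = j then cf j v else 0)"
    unfolding P_def c_sums using j by (intro sum.cong) (auto simp: c_simps cf_f)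
  then show ?thesis using j by (simp add: sum.delta)
qed

lemma F_K: "v \<in> span (f ` {1..k}) \<Longrightarrow> v \<in> K"
proof -
  have "f ` {1..k} \<subseteq> K" by (auto intro!: f_K)
  then have "span (f ` {1..k}) \<subseteq> K" by (rule span_minimal[OF _ K_subspace])
  then show "v \<in> span (f ` {1..k}) \<Longrightarrow> v \<in> K" by blast
qed

lemma P_on_F: assumes "v \<in> span (f ` {1..k})" shows "P v = v"
proof -
  interpret P: module_hom scale scale P by (rule P_hom)
  have Pf: "P (f j) = f j" if "j \<in> {1..k}" for j
  proof -
    have "P (f j) = (\<Sum>i = 1..k. if i = j then f j else 0)"
      unfolding P_def using that by (intro sum.cong) (auto simp: cf_f)
    then show ?thesis using that by (simp add: sum.delta)
  qed
  show ?thesis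
    using assms by (induction rule: span_induct_alt) (auto simp: P.add P.scale Pf)
qed

lemma P_diff_M: assumes "v \<in> N" "ce 1 v = 0" shows "v - P v \<in> M"
proof -
  have P: "P v \<in> K" by (rule F_K[OF P_F])
  show ?thesis using assms P by (auto simp: M_def N_closed K_N c_simps K_ce1 cf_P)
qed

text \<open>Identifies the projection in the hypothesis with a formula in coordinates.\<close>

lemma projection_along_F:
  assumes v: "v \<in> N"
  shows "projection_along (span (f ` {1..k})) (span (e ` {1..m} \<union> f ` {k+1..2*k})) v = P v"
  unfolding projection_along_def
proof (rule the_equality)
  let ?W = "span (e ` {1..m} \<union> f ` {k+1..2*k})"
  have "(\<Sum>j = 1..2*k. scale (cf j v) (f j)) = P v + (\<Sum>j = k+1..2*k. scale (cf j v) (f j))"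
    using sum.ub_add_nat[of 1 k "\<lambda>j. scale (cf j v) (f j)" k] by (simp add: P_def mult_2)
  then have "v - P v = (\<Sum>i = 1..m. scale (ce i v) (e i)) + (\<Sum>j = k+1..2*k. scale (cf j v) (f j))"
    using expand[OF v] by (simp add: algebra_simps)
  also have "\<dots> \<in> ?W" by (intro span_add span_sum span_scale span_base) auto
  finally show "P v \<in> span (f ` {1..k}) \<and> v - P v \<in> ?W" using P_F by blast
  fix u assume u: "u \<in> span (f ` {1..k}) \<and> v - u \<in> ?W"
  have W: "cf j w = 0" if "w \<in> ?W" "j \<in> {1..k}" for w j
    using that(1)
    by (induction rule: span_induct_alt) (use that(2) in \<open>auto simp: c_simps cf_e cf_f\<close>)
  have "cf j u = cf j v" if "j \<in> {1..k}" for j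
    using W[of "v - u" j] u that by (simp add: c_simps)
  then have "P u = P v" by (simp add: P_def)
  then show "u = P v" using u by (simp add: P_on_F)
qed

text \<open>By \<open>cf1_right_mult\<close> the $f_1$-coordinate is a left eigenvector of the Jordan block, for the
  eigenvalue $\psi([e_1,x])$. A Jordan block has a single eigenvalue, and its left eigenvector sees only the
  top vector of the chain.\<close>

lemma psi_eigenvalue:
  assumes gs: "span (set gs) = span (f ` {1..k})" "length gs = k"
    and g0: "P (bracket (gs ! 0) x) = scale lam (gs ! 0)"
    and gS: "\<And>j. Suc j < k \<Longrightarrow> P (bracket (gs ! Suc j) x) = scale lam (gs ! Suc j) + gs ! j"
  shows "psi (bracket (e 1) x) = lam" "\<And>j. Suc j < k \<Longrightarrow> cf 1 (gs ! j) = 0"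
proof -
  define \<mu> where "\<mu> = psi (bracket (e 1) x)"
  have k1: "1 \<in> {1..k}" using k2 by auto
  have gF: "gs ! j \<in> span (f ` {1..k})" if "j < k" for j
    using that gs by (metis nth_mem span_base)
  have \<mu>: "cf 1 (P (bracket (gs ! j) x)) = \<mu> * cf 1 (gs ! j)" if "j < k" for j
    using cf1_right_mult[OF F_K[OF gF[OF that]], of x] k1 by (simp add: cf_P \<mu>_def)
  \<comment> \<open>If the two eigenvalues differed, the $f_1$-coordinate would vanish along the chain, hence on $f_1$.\<close>
  have e0: "(\<mu> - lam) * cf 1 (gs ! 0) = 0"
  proof -
    have "lam * cf 1 (gs ! 0) = \<mu> * cf 1 (gs ! 0)"
      using \<mu>[of 0] k2 by (simp add: g0 c_simps del: mult_cancel_right)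
    then show ?thesis by (simp only: left_diff_distrib diff_self)
  qed
  have eS: "(\<mu> - lam) * cf 1 (gs ! Suc j) = cf 1 (gs ! j)" if "Suc j < k" for j
    using \<mu>[of "Suc j"] that by (simp add: gS c_simps algebra_simps)
  have "\<mu> = lam"
  proof (rule ccontr)
    assume ne: "\<mu> \<noteq> lam"
    have "cf 1 (gs ! j) = 0" if "j < k" for j
      using that
    proof (induction j)
      case 0
      then show ?case using e0 ne by simp
    next
      case (Suc j)
      then show ?case using eS[of j] ne by simp
    qed
    then have z: "cf 1 v = 0" if "v \<in> set gs" for v using that gs by (auto simp: in_set_conv_nth)
    have "cf 1 v = 0" if "v \<in> span (set gs)" for v
      using that by (induction rule: span_induct_alt) (auto simp: c_simps z)
    moreover have "f 1 \<in> span (set gs)" unfolding gs(1) using k1 by (intro span_base imageI)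
    ultimately show False using cf1_f1 by simp
  qed
  then show "psi (bracket (e 1) x) = lam" by (simp add: \<mu>_def)
  show "cf 1 (gs ! j) = 0" if "Suc j < k" for j
    using eS[OF that] \<open>\<mu> = lam\<close> by simp
qed

text \<open>The functional $f_1$-coordinate vanishes on all but the top vector of the Jordan chain and is $1$ at
  $h$; so $h$ involves the top vector and is cyclic. Modulo \<open>M\<close> the compression $U$ of $T$ to
  $\mathcal{F}$ agrees with $T$.\<close>

lemma adapted_from_jordan_block:
  assumes gs: "span (set gs) = span (f ` {1..k})" "length gs = k"
    and g0: "P (bracket (gs ! 0) x) = scale lam (gs ! 0)"
    and gS: "\<And>j. Suc j < k \<Longrightarrow> P (bracket (gs ! Suc j) x) = scale lam (gs ! Suc j) + gs ! j"
    and lam: "lam \<noteq> 0" and xx: "bracket x x \<in> N"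
  shows "\<exists>h. adapted (scale (1 / lam) x) h"
proof -
  let ?F = "span (f ` {1..k})"
  define x' where "x' = scale (1 / lam) x"
  define h where "h = P (bracket (e 1) x')"
  define U where "U v = P (T x' v)" for v
  interpret P: module_hom scale scale P by (rule P_hom)
  have U_hom: "module_hom scale scale U"
    unfolding U_def by unfold_locales (simp_all add: T_simps P.add P.scale)
  have gF: "gs ! j \<in> ?F" if "j < k" for j
    using that gs by (metis nth_mem span_base)
  have Ug: "U v = scale (1 / lam) (P (bracket v x)) - v" if "v \<in> ?F" for v
    using that by (simp add: U_def T_def x'_def bracket_simps P.diff P.scale P_on_F)
  have U0: "U (gs ! 0) = 0" using k2 lam gF[of 0] by (simp add: Ug g0)
  have US: "U (gs ! Suc j) = scale (1 / lam) (gs ! j)" if "Suc j < k" for j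
    using that lam gF[of "Suc j"] by (simp add: Ug gS scale_right_distrib)
  have k1: "1 \<in> {1..k}" using k2 by auto
  have psi: "psi (bracket (e 1) x') = 1"
    using psi_eigenvalue(1)[OF gs g0 gS] lam by (simp add: x'_def bracket_simps psi_simps)
  have h1: "cf 1 h = 1" using k1 psi by (simp add: h_def cf_P psi_right_mult_e1)
  have hF: "h \<in> ?F" unfolding h_def by (rule P_F)
  have set_gs: "set gs = (\<lambda>i. gs ! i) ` {..<k}" using gs by (auto simp: set_conv_nth)
  have "h \<in> span ((\<lambda>i. gs ! i) ` {..<k})" using hF gs set_gs by simp
  then obtain a where a: "h = (\<Sum>i<k. scale (a i) (gs ! i))" by (rule span_image_lessThan)
  have "cf 1 h = (\<Sum>i<k. a i * cf 1 (gs ! i))" unfolding a c_sums by (simp add: c_simps)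
  also have "\<dots> = a (k - 1) * cf 1 (gs ! (k - 1))"
  proof -
    have "{..<k} = insert (k - 1) {..<k - 1}" using k2 by auto
    then show ?thesis using psi_eigenvalue(2)[OF gs g0 gS] k2 by simp
  qed
  finally have top: "a (k - 1) \<noteq> 0" using h1 by auto
  have k0: "k > 0" "1 / lam \<noteq> 0" using k2 lam by auto
  note chain = jordan_chain_cyclic[OF U_hom U0 US k0(2) a k0(1) top]
  have UF: "(U ^^ j) h \<in> ?F" for j by (cases j) (simp_all add: hF U_def P_F)
  have TU: "(T x' ^^ j) h - (U ^^ j) h \<in> M" for j
  proof (induction j)
    case (Suc j)
    have TUK: "T x' ((U ^^ j) h) \<in> K" by (intro T_K F_K UF)
    have "(T x' ^^ Suc j) h - (U ^^ Suc j) h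
        = T x' ((T x' ^^ j) h - (U ^^ j) h) + (T x' ((U ^^ j) h) - P (T x' ((U ^^ j) h)))"
      by (simp add: T_simps U_def)
    moreover have "T x' ((T x' ^^ j) h - (U ^^ j) h) \<in> M"
      using T_pow_M[OF Suc, of "Suc 0" x'] by simp
    moreover have "T x' ((U ^^ j) h) - P (T x' ((U ^^ j) h)) \<in> M"
      using TUK by (intro P_diff_M K_N K_ce1)
    ultimately show ?case by (simp only: M_closed)
  qed (simp add: M_closed)
  have "adapted x' h" unfolding adapted_def
  proof (intro conjI ballI)
    show "bracket x' x' \<in> N" using xx by (simp add: x'_def bracket_simps N_closed)
    show "h \<in> K" by (rule F_K[OF hF])
    show "cf 1 h = 1" by (rule h1)
    show "bracket (e 1) x' - h \<in> M" unfolding h_def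
      by (intro P_diff_M N_closed e1_N ce1_right_mult_zero)
    show "(T x' ^^ k) h \<in> M" using TU[of k] chain(1) by simp
    fix v assume v: "v \<in> K"
    have "set gs \<subseteq> span ((\<lambda>j. (U ^^ j) h) ` {..<k})"
      using chain(2) by (auto simp: set_gs)
    then have "P v \<in> span ((\<lambda>j. (U ^^ j) h) ` {..<k})"
      using span_minimal[OF _ subspace_span] gs P_F[of v] by blast
    then obtain c where c: "P v = (\<Sum>j<k. scale (c j) ((U ^^ j) h))" by (rule span_image_lessThan)
    have "v - (\<Sum>j<k. scale (c j) ((T x' ^^ j) h))
        = (v - P v) - (\<Sum>j<k. scale (c j) ((T x' ^^ j) h - (U ^^ j) h))"
      unfolding c by (simp add: scale_right_diff_distrib sum_subtractf)
    also have "\<dots> \<in> M"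
      by (rule M_closed(2)[OF P_diff_M[OF K_N[OF v] K_ce1[OF v]]]) (intro M_closed TU)
    finally show "\<exists>c. v - (\<Sum>j<k. scale (c j) ((T x' ^^ j) h)) \<in> M" by blast
  qed
  then show ?thesis unfolding x'_def by blast
qed

end

section \<open>The multiplication table of a normal form\<close>

context mu2_in_leibniz
begin

context
  fixes x h \<xi> \<alpha> \<gamma>
  assumes nf: "normal_form x h \<xi> \<alpha> \<gamma>"
begin

definition new_e :: "nat \<Rightarrow> 'a" where
  "new_e i = (S ^^ (i - 1)) (e 1 + \<xi>)"
definition new_f :: "nat \<Rightarrow> 'a" where
  "new_f j = (if j \<le> k then (T x ^^ (j - 1)) h else J ((T x ^^ (j - k - 1)) h))"

lemma nf_ad: "adapted x h" and nf_Tk: "(T x ^^ k) h = 0" and nf_left: "bracket x (e 1) + h \<in> G"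
    and nf_left_kernel: "bracket (bracket x (e 1) + h) x = 0" and nf_Z: "Z x ((T x ^^ j) h) = 0"
    and nf_\<xi>: "\<xi> \<in> M" and nf_right: "bracket (e 1 + \<xi>) x = h + scale \<alpha> (J h)"
    and nf_square: "bracket x x = scale \<gamma> (J h)"
  using nf by (auto simp: normal_form_def)

lemmas nf_h = adapted_props[OF nf_ad]

lemma new_e_1: "new_e 1 = e 1 + \<xi>"
  by (simp add: new_e_def)
lemma new_e_Suc: "i \<ge> 1 \<Longrightarrow> new_e (Suc i) = S (new_e i)"
proof -
  assume "i \<ge> 1"
  then have "Suc i - 1 = Suc (i - 1)" by simp
  then show ?thesis unfolding new_e_def by (simp only: funpow.simps o_apply)
qed
lemma new_e_2: "new_e 2 = e 2 + S \<xi>"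
  using new_e_Suc[of 1] by (simp add: new_e_1 SJ_simps Se1 Suc_1)

lemma new_e_E: "i \<ge> 2 \<Longrightarrow> new_e i \<in> E i"
proof (induction i rule: dec_induct)
  case base
  have "e 2 \<in> E 2" using m4 by (intro e_E) auto
  moreover have "S \<xi> \<in> E 2" using S_M_E[OF nf_\<xi>] by (rule E_mono[rotated]) simp
  ultimately show ?case unfolding new_e_2 by (rule E_closed)
next
  case (step i)
  then show ?case using S_E[of "new_e i" i] by (simp add: new_e_Suc flip: Suc_eq_plus1)
qed

lemma new_e_diff: "i \<ge> 2 \<Longrightarrow> i \<le> m \<Longrightarrow> new_e i - e i \<in> E (i + 1)"
proof (induction i rule: dec_induct)
  case base
  show ?case using S_M_E[OF nf_\<xi>] by (simp add: new_e_2)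
next
  case (step i)
  have "new_e (Suc i) - e (Suc i) = S (new_e i - e i)"
    using step S_e[of i] by (simp add: new_e_Suc SJ_simps flip: Suc_eq_plus1)
  moreover have "S (new_e i - e i) \<in> E (i + 1 + 1)" by (rule S_E) (use step in auto)
  ultimately show ?case by (simp flip: Suc_eq_plus1)
qed

lemma new_e_M: "i \<ge> 2 \<Longrightarrow> new_e i \<in> M"
  by (rule E_M[OF _ new_e_E])
lemma new_e_N: "i \<ge> 1 \<Longrightarrow> new_e i \<in> N"
  using new_e_M[of i] by (cases "i = 1") (auto simp: M_N new_e_1 intro!: N_closed e1_N M_N[OF nf_\<xi>])
lemma ce1_new_e: "i \<ge> 1 \<Longrightarrow> ce 1 (new_e i) = (if i = 1 then 1 else 0)"
  using new_e_M[of i] nf_\<xi> by (auto simp: M_ce1 new_e_1 c_simps ce1_e1)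
lemma psi_new_e: "i \<ge> 1 \<Longrightarrow> psi (new_e i) = (if i = 1 then 1 else 0)"
  using new_e_M[of i] nf_\<xi> by (auto simp: M_psi new_e_1 psi_simps psi_e1)
lemma J_new_e: "i \<ge> 1 \<Longrightarrow> J (new_e i) = 0"
  using new_e_M[of i] nf_\<xi> by (cases "i = 1") (auto simp: J_M new_e_1 SJ_simps J_e1)
lemma new_e_last: "S (new_e m) = 0"
  using E_last[of "new_e (m + 1)"] new_e_E[of "m + 1"] m4 new_e_Suc[of m] by (simp add: Suc_eq_plus1)

lemma new_f_F: "j \<le> k \<Longrightarrow> new_f j = (T x ^^ (j - 1)) h"
  by (simp add: new_f_def)
lemma new_f_G: "new_f (k + Suc j) = J ((T x ^^ j) h)"
  by (simp add: new_f_def)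
lemma new_f_K: "new_f j \<in> K"
  by (simp add: new_f_def T_pow_K nf_h G_K J_G)
lemma new_f_in_G: "j > k \<Longrightarrow> new_f j \<in> G"
  by (simp add: new_f_def J_G)
lemma new_f_1: "new_f 1 = h" and new_f_Suc_k: "new_f (k + 1) = J h"
  using k2 new_f_G[of 0] by (simp_all add: new_f_F One_nat_def)
lemma cf1_new_f: "j \<in> {1..k} \<Longrightarrow> cf 1 (new_f j) = (if j = 1 then 1 else 0)"
  using adapted_cf1_T_pow[OF nf_ad, of "j - 1"] by (auto simp: new_f_F nf_h)
lemma J_new_f: "j \<in> {1..k} \<Longrightarrow> J (new_f j) = new_f (k + j)"
  by (auto simp: new_f_def)

text \<open>Modulo the filtration the new vectors play the same roles as the old ones: $e'_1$ acts like $e_1$,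
  $f'_1$ has $f_1$-coordinate $1$ and the other $f'_j$ have $f_1$-coordinate $0$.\<close>

lemma new_products: "mu2_products (m + 2*k) k new_e new_f"
  unfolding mu2_products_def diff_add_inverse2
proof (intro conjI ballI)
  fix i j assume i: "i \<in> {1..m}" and j: "j \<in> {1..m}"
  have "i \<ge> 1" "j \<ge> 1" using i j by auto
  then have "bracket (new_e i) (new_e j) = (if j = 1 then S (new_e i) else 0)"
    by (simp add: bracket_N new_e_N psi_new_e J_new_e)
  also have "S (new_e i) = (if i \<le> m - 1 then new_e (i + 1) else 0)"
    using i m4 new_e_Suc[of i] new_e_last by (cases "i = m") (auto simp: Suc_eq_plus1)
  finally show "bracket (new_e i) (new_e j) = (if j = 1 \<and> i \<le> m - 1 then new_e (i + 1) else 0)"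
    by simp
next
  fix i j assume i: "i \<in> {1..m}" and j: "j \<in> {1..2*k}"
  have i1: "i \<ge> 1" using i by auto
  have br: "bracket (new_e i) (new_f j) = scale (cf 1 (new_f j)) (S (new_e i)) + (if i = 1 then J (new_f j) else 0)"
    using i1 new_f_K[of j] by (simp add: bracket_N new_e_N K_N K_psi ce1_new_e)
  have S: "S (new_e i) = (if i \<le> m - 1 then new_e (i + 1) else 0)"
    using i m4 new_e_Suc[of i] new_e_last by (cases "i = m") (auto simp: Suc_eq_plus1)
  show "bracket (new_e i) (new_f j) = (if i = 1 \<and> j = 1 then new_e 2 + new_f (k + 1)
           else if 2 \<le> i \<and> i \<le> m - 1 \<and> j = 1 then new_e (i + 1)
           else if i = 1 \<and> 2 \<le> j \<and> j \<le> k then new_f (k + j)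
           else 0)"
  proof (cases "j \<le> k")
    case True
    then have j': "j \<in> {1..k}" using j by auto
    show ?thesis
      unfolding br S J_new_f[OF j'] cf1_new_f[OF j'] using i1 j' m4
      by (cases "i = 1"; cases "j = 1") (auto simp: one_add_one)
  next
    case False
    then have "new_f j \<in> M" using new_f_in_G[of j] by (simp add: G_M)
    then show ?thesis using False k2 by (simp add: bracket_M_right)
  qed
next
  fix i j assume "j \<in> {1..m}"
  then show "bracket (new_f i) (new_e j) = 0" by (simp add: bracket_K_left new_f_K new_e_N)
next
  fix i j show "bracket (new_f i) (new_f j) = 0" by (simp add: bracket_K_left new_f_K K_N)
qed

lemma right_mult_new_e_1: "bracket (new_e 1) x = new_f 1 + scale \<alpha> (new_f (k + 1))"
  unfolding new_e_1 new_f_1 new_f_Suc_k by (rule nf_right)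

lemma right_mult_new_e_2: "bracket (new_e 2) x = new_e 2 + new_f (k + 1)"
proof -
  have K: "h + scale \<alpha> (J h) \<in> K" by (intro K_closed nf_h G_K J_G)
  have b: "bracket (new_e 1) (new_e 1) = new_e 2"
    using new_e_Suc[of 1] by (simp add: bracket_N new_e_N psi_new_e J_new_e numeral_2_eq_2 One_nat_def)
  have "bracket (new_e 1) (h + scale \<alpha> (J h)) = S (new_e 1) + J h"
    using nf_h by (simp add: bracket_N new_e_N K K_N K_psi c_simps ce1_new_e SJ_simps M_cf1 G_M J_G J_M)
  then have "bracket (new_e 1) (bracket (new_e 1) x) = new_e 2 + new_f (k + 1)"
    using new_e_Suc[of 1] unfolding right_mult_new_e_1 new_f_1 new_f_Suc_k by (simp add: numeral_2_eq_2 One_nat_def)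
  moreover have "bracket (bracket (new_e 1) x) (new_e 1) = 0"
    unfolding right_mult_new_e_1 new_f_1 new_f_Suc_k by (simp add: bracket_K_left K new_e_N)
  ultimately show ?thesis using right_mult_derivation[of "new_e 1" "new_e 1" x] by (simp add: b)
qed

text \<open>Starts from $[e'_2,x] = e'_2 + f'_{k+1}$; the second term is killed by \<open>S\<close>, and each application of
  \<open>S\<close> adds $1$ to the eigenvalue.\<close>

lemma right_mult_new_e: "3 \<le> i \<Longrightarrow> bracket (new_e i) x = scale (of_nat (i - 1)) (new_e i)"
proof (induction i rule: dec_induct)
  case base
  have "bracket (S (new_e 2)) x = S (bracket (new_e 2) x) + S (new_e 2)"
    by (rule adapted_right_mult_S[OF nf_ad]) (simp_all add: new_e_N ce1_new_e)
  moreover have "S (new_e 2) = new_e 3" using new_e_Suc[of 2] by (simp add: numeral_3_eq_3 numeral_2_eq_2)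
  moreover have "S (new_f (k + 1)) = 0" by (intro S_K new_f_K)
  ultimately show ?case
    by (simp add: right_mult_new_e_2 SJ_simps scale_left_distrib[of 1 1, simplified])
next
  case (step i)
  have "bracket (S (new_e i)) x = S (bracket (new_e i) x) + S (new_e i)"
    using step by (intro adapted_right_mult_S[OF nf_ad]) (simp_all add: new_e_N ce1_new_e)
  moreover have "scale (of_nat i) (S (new_e i)) = scale (of_nat (i - 1)) (S (new_e i)) + S (new_e i)"
    using step by (cases i) (simp_all add: scale_left_distrib add.commute)
  ultimately show ?case using step by (simp add: new_e_Suc SJ_simps)
qed

lemma right_mult_new_f: "i \<in> {1..k - 1} \<Longrightarrow> bracket (new_f i) x = new_f i + new_f (i + 1)"
proof -
  assume i: "i \<in> {1..k - 1}"
  then have eq: "i = Suc (i - 1)" "i \<le> k" "i + 1 \<le> k" by auto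
  have "new_f (i + 1) = T x (new_f i)"
    using eq(2,3) by (subst (2) eq(1)) (simp add: new_f_F, metis eq(1) comp_apply funpow.simps(2))
  then show ?thesis by (simp add: bracket_eq_T add.commute)
qed

lemma right_mult_new_f_k: "bracket (new_f k) x = new_f k"
proof -
  have "(T x ^^ Suc (k - 1)) h = (T x ^^ k) h" using k2 by simp
  then have "T x (new_f k) = (T x ^^ k) h" by (simp add: new_f_F)
  then show ?thesis by (simp add: bracket_eq_T nf_Tk)
qed

lemma left_mult_new_f: "i \<in> {1..k} \<Longrightarrow> bracket x (new_f i) = - bracket (new_f i) x"
proof -
  assume "i \<in> {1..k}"
  then have "Z x (new_f i) = 0" using nf_Z[of "i - 1"] by (simp add: new_f_F)
  then show ?thesis by (simp add: Z_def eq_neg_iff_add_eq_0 add.commute)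
qed

lemma right_mult_new_f_Suc_k: "bracket (new_f (k + 1)) x = new_f (k + 2)"
  using adapted_right_mult_Jh[OF nf_ad] new_f_G[of 1] unfolding new_f_Suc_k by (simp add: One_nat_def numeral_2_eq_2)

lemma right_mult_new_f_G: assumes i: "i \<in> {k + 2..2*k}" shows "bracket (new_f i) x = new_f i + (if i < 2*k then new_f (i + 1) else 0)"
proof -
  define j where "j = i - k - 1"
  have j: "j > 0" "i = k + Suc j" "i + 1 = k + Suc (Suc j)" using i by (auto simp: j_def)
  have fi: "new_f i = J ((T x ^^ j) h)" unfolding j(2) by (rule new_f_G)
  have fi1: "new_f (i + 1) = J ((T x ^^ Suc j) h)" unfolding j(3) by (rule new_f_G)
  have b: "bracket (new_f i) x = new_f i + new_f (i + 1)"
    unfolding fi fi1 by (rule adapted_right_mult_g[OF nf_ad j(1)])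
  have "new_f (i + 1) = 0" if "\<not> i < 2*k"
    unfolding fi1 using that j i by (intro adapted_g_zero[OF nf_ad]) auto
  with b show ?thesis by auto
qed

lemma left_mult_new_e_1: "\<exists>\<beta>. bracket x (new_e 1) = - new_f 1 + scale \<beta> (\<Sum>i = 1..k. scale ((- 1) ^ (i - 1)) (new_f (k + i)))"
proof -
  obtain \<beta> where "bracket x (e 1) + h = scale \<beta> (\<Sum>j<k. scale ((- 1) ^ j) (J ((T x ^^ j) h)))"
    using adapted_G_kernel[OF nf_ad nf_left nf_left_kernel] by blast
  moreover have "(\<Sum>j<k. scale ((- 1) ^ j) (J ((T x ^^ j) h)))
      = (\<Sum>i = 1..k. scale ((- 1) ^ (i - 1)) (new_f (k + i)))"
    by (rule sum.reindex_bij_witness[of _ "\<lambda>i. i - 1" Suc]) (auto simp: new_f_def)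
  moreover have "bracket x (new_e 1) = bracket x (e 1)"
    by (simp add: new_e_1 bracket_simps bracket_M_right nf_\<xi>)
  ultimately have "bracket x (new_e 1) = - new_f 1 + scale \<beta> (\<Sum>i = 1..k. scale ((- 1) ^ (i - 1)) (new_f (k + i)))"
    by (simp add: new_f_1 algebra_simps)
  then show ?thesis by blast
qed

text \<open>Peel off the filtration from $e_m$ upwards to get \<open>E 2\<close>, then \<open>G\<close> from the chain $J T^j h$, hence \<open>M\<close>;
  cyclicity gives \<open>K\<close>, and $e_1 = e'_1 - \xi$.\<close>

lemma N_in_new_span:
  assumes W: "subspace W" and new_e_W: "\<And>i. i \<in> {1..m} \<Longrightarrow> new_e i \<in> W"
    and new_f_W: "\<And>j. j \<in> {1..2*k} \<Longrightarrow> new_f j \<in> W"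
  shows "N \<subseteq> W"
proof
  note W_closed = subspace_add[OF W] subspace_diff[OF W] subspace_scale[OF W] subspace_sum[OF W]
    subspace_0[OF W]
  have E_W: "v \<in> W" if "2 \<le> i" "i \<le> m + 1" "v \<in> E i" for i v
    using that
  proof (induction "m + 1 - i" arbitrary: i v)
    case 0
    then have "v = 0" using E_last[of v] by (cases "i = m + 1") auto
    then show ?case by (simp add: W_closed)
  next
    case (Suc n)
    have i: "i \<in> {1..m}" "2 \<le> i" "i \<le> m" using Suc by auto
    have "v = scale (ce i v) (new_e i) + ((v - scale (ce i v) (e i)) - scale (ce i v) (new_e i - e i))"
      by (simp add: scale_right_diff_distrib)
    moreover have "(v - scale (ce i v) (e i)) - scale (ce i v) (new_e i - e i) \<in> W"
    proof (rule Suc(1))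
      show "n = m + 1 - (i + 1)" using Suc(2) by arith
      show "(v - scale (ce i v) (e i)) - scale (ce i v) (new_e i - e i) \<in> E (i + 1)"
        by (rule E_closed(2)[OF E_step[OF i(1) Suc(5)] E_closed(4)[OF new_e_diff[OF i(2,3)]]])
    qed (use i in auto)
    ultimately show ?case using W_closed(1)[OF W_closed(3)[OF new_e_W[OF i(1)]]] by metis
  qed
  have G_W: "v \<in> W" if v: "v \<in> G" for v
  proof -
    obtain c where c: "v = (\<Sum>j<k. scale (c j) (J ((T x ^^ j) h)))" using adapted_G_span[OF nf_ad v] .
    have "J ((T x ^^ j) h) \<in> W" if "j < k" for j
      using new_f_W[of "k + Suc j"] that by (simp only: new_f_G) simp
    then show ?thesis unfolding c by (intro W_closed) auto
  qed
  have M_W: "v \<in> W" if v: "v \<in> M" for v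
  proof -
    obtain u where u: "u \<in> E 2" "v - u \<in> G" using M_decomp_E[OF v] by blast
    have "u \<in> W" using E_W[of 2 u] u m4 by simp
    then show ?thesis using W_closed(1)[OF G_W[OF u(2)]] by fastforce
  qed
  have K_W: "v \<in> W" if "v \<in> K" for v
  proof -
    obtain c where c: "v - (\<Sum>j<k. scale (c j) ((T x ^^ j) h)) \<in> M"
      using nf_ad \<open>v \<in> K\<close> by (auto simp: adapted_def)
    have T: "(T x ^^ j) h \<in> W" if "j < k" for j
      using new_f_W[of "Suc j"] that by (simp add: new_f_F)
    then have "(\<Sum>j<k. scale (c j) ((T x ^^ j) h)) \<in> W" by (intro W_closed) auto
    then show ?thesis using W_closed(1)[OF M_W[OF c]] by fastforce
  qed
  have e1: "e 1 \<in> W"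
    using W_closed(2)[OF new_e_W[of 1] M_W[OF nf_\<xi>]] m4 by (simp add: new_e_1)
  have e_W: "e i \<in> W" if "i \<in> {1..m}" for i
    using e1 M_W[OF e_M[of i]] that by (cases "i = 1") auto
  fix v assume v: "v \<in> N"
  show "v \<in> W"
    by (subst expand[OF v]) (intro W_closed e_W K_W f_K; simp)
qed

end

lemma normal_form_table:
  assumes nf: "normal_form x h \<xi> \<alpha> \<gamma>"
    and UNIV: "span (N \<union> {x}) = UNIV" and dim: "dim UNIV = m + 2*k + 1"
  shows "\<exists>(\<alpha>::complex) (\<beta>::complex) (\<gamma>::complex) (e'::nat \<Rightarrow> 'a) (f'::nat \<Rightarrow> 'a) (x'::'a).
      is_basis (mu2_vectors (m + 2*k) k e' f' @ [x']) UNIV \<and>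
      mu2_products (m + 2*k) k e' f' \<and>
      bracket (e' 1) x' = f' 1 + scale \<alpha> (f' (k + 1)) \<and>
      bracket (e' 2) x' = e' 2 + f' (k + 1) \<and>
      (\<forall>i\<in>{3..m}. bracket (e' i) x' = scale (of_nat (i - 1)) (e' i)) \<and>
      (\<forall>i\<in>{1..k - 1}. bracket (f' i) x' = f' i + f' (i + 1)) \<and>
      (\<forall>i\<in>{1..k - 1}. bracket x' (f' i) = - (f' i + f' (i + 1))) \<and>
      bracket (f' k) x' = f' k \<and>
      bracket x' (f' k) = - f' k \<and>
      bracket (f' (k + 1)) x' = f' (k + 2) \<and>
      (\<forall>i\<in>{k + 2..2*k - 1}. bracket (f' i) x' = f' i + f' (i + 1)) \<and>
      bracket (f' (2*k)) x' = f' (2*k) \<and>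
      bracket x' (e' 1) = - f' 1 + scale \<beta> (\<Sum>i = 1..k. scale ((-1) ^ (i - 1)) (f' (k + i))) \<and>
      (\<forall>i\<in>{2..m}. bracket x' (e' i) = 0) \<and>
      (\<forall>i\<in>{k + 1..2*k}. bracket x' (f' i) = 0) \<and>
      bracket x' x' = scale \<gamma> (f' (k + 1))"
proof -
  let ?e = "new_e \<xi>" and ?f = "new_f x h"
  obtain \<beta> where \<beta>: "bracket x (?e 1) = - ?f 1 + scale \<beta> (\<Sum>i = 1..k. scale ((- 1) ^ (i - 1)) (?f (k + i)))"
    using left_mult_new_e_1[OF nf] by blast
  let ?vs = "mu2_vectors (m + 2*k) k ?e ?f @ [x]"
  have set: "set ?vs = ?e ` {1..m} \<union> ?f ` {1..2*k} \<union> {x}"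
    by (auto simp: mu2_vectors_def atLeastLessThanSuc_atLeastAtMost)
  have len: "length ?vs = dim UNIV" by (simp add: mu2_vectors_def dim)
  have "N \<subseteq> span (set ?vs)"
    unfolding set by (rule N_in_new_span[OF nf subspace_span]) (auto intro!: span_base)
  moreover have "x \<in> span (set ?vs)" unfolding set by (rule span_base) simp
  ultimately have "N \<union> {x} \<subseteq> span (set ?vs)" by blast
  then have span: "span (set ?vs) = UNIV" using span_minimal[OF _ subspace_span] UNIV by blast
  have basis: "is_basis ?vs UNIV"
    unfolding is_basis_def using spanning_list_basis[OF span len] span by blast
  show ?thesis
  proof (intro exI conjI ballI)
    show "is_basis ?vs UNIV" by (rule basis)
    show "mu2_products (m + 2*k) k ?e ?f" by (rule new_products[OF nf])
    show "bracket (?e 1) x = ?f 1 + scale \<alpha> (?f (k + 1))" by (rule right_mult_new_e_1[OF nf])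
    show "bracket (?e 2) x = ?e 2 + ?f (k + 1)" by (rule right_mult_new_e_2[OF nf])
    show "bracket (?e i) x = scale (of_nat (i - 1)) (?e i)" if "i \<in> {3..m}" for i
      using that right_mult_new_e[OF nf] by simp
    show D: "bracket (?f i) x = ?f i + ?f (i + 1)" if "i \<in> {1..k - 1}" for i
      using that by (rule right_mult_new_f[OF nf])
    show "bracket x (?f i) = - (?f i + ?f (i + 1))" if "i \<in> {1..k - 1}" for i
      using left_mult_new_f[OF nf, of i] D[OF that] that by auto
    show "bracket (?f k) x = ?f k" by (rule right_mult_new_f_k[OF nf])
    show "bracket x (?f k) = - ?f k" using left_mult_new_f[OF nf, of k] right_mult_new_f_k[OF nf] k2 by simp
    show "bracket (?f (k + 1)) x = ?f (k + 2)" by (rule right_mult_new_f_Suc_k[OF nf])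
    show "bracket (?f i) x = ?f i + ?f (i + 1)" if "i \<in> {k + 2..2*k - 1}" for i
      using right_mult_new_f_G[OF nf, of i] that k2 by auto
    show "bracket (?f (2*k)) x = ?f (2*k)" using right_mult_new_f_G[OF nf, of "2*k"] k2 by simp
    show "bracket x (?e 1) = - ?f 1 + scale \<beta> (\<Sum>i = 1..k. scale ((- 1) ^ (i - 1)) (?f (k + i)))"
      by (rule \<beta>)
    show "bracket x (?e i) = 0" if "i \<in> {2..m}" for i
      using that by (intro bracket_M_right new_e_M[OF nf]) auto
    show "bracket x (?f i) = 0" if "i \<in> {k + 1..2*k}" for i
      using that by (intro bracket_M_right G_M new_f_in_G[OF nf]) auto
    show "bracket x x = scale \<gamma> (?f (k + 1))"
      using nf_square[OF nf] new_f_Suc_k[OF nf] by simp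
  qed
qed

end

section \<open>From the hypotheses to coordinates\<close>

context leibniz_algebra
begin

text \<open>The list of basis vectors of $N$ followed by $x$ spans and has as many entries as the dimension, so it
  is a basis, and its coordinate functionals are defined everywhere.\<close>

lemma mu2_coordinates:
  assumes m4: "m \<ge> 4" and k2: "k \<ge> 2" and ideal: "two_sided_ideal N"
    and basis: "is_basis (mu2_vectors (m + 2*k) k e f) N"
    and table: "mu2_products (m + 2*k) k e f"
    and span: "span (N \<union> {x}) = UNIV" and dim: "dim UNIV = m + 2*k + 1"
  shows "\<exists>ce cf. mu2_in_leibniz scale bracket m k N e f ce cf"
proof -
  let ?us = "mu2_vectors (m + 2*k) k e f" and ?vs = "mu2_vectors (m + 2*k) k e f @ [x]"
  have N: "N = span (set ?us)" and ind_us: "independent (set ?us)" and dist_us: "distinct ?us"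
    using basis by (simp_all add: is_basis_def)
  have us: "set ?us = e ` {1..m} \<union> f ` {1..2*k}"
    by (auto simp: mu2_vectors_def atLeastLessThanSuc_atLeastAtMost)
  have "N \<union> {x} \<subseteq> span (set ?vs)"
    unfolding N using span_mono[of "set ?us" "set ?vs"] by (auto intro: span_base)
  then have span_vs: "span (set ?vs) = UNIV" using span_minimal[OF _ subspace_span] span by blast
  have "length ?vs = dim UNIV" by (simp add: mu2_vectors_def dim)
  note vs = spanning_list_basis[OF span_vs this]
  define B where "B = set ?vs"
  have B: "independent B" "span B = UNIV" "set ?us \<subseteq> B"
    using vs(2) span_vs by (auto simp: B_def)
  have ivl: "{1..<l + 1} = {1..l}" for l :: nat by auto
  have inj: "inj_on e {1..m}" "inj_on f {1..2*k}" "e ` {1..m} \<inter> f ` {1..2*k} = {}"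
    using dist_us by (simp_all add: mu2_vectors_def distinct_map ivl)
  have rep: "representation B b c = (if c = b then 1 else 0)" if "b \<in> B" for b c
    using representation_basis[OF B(1) that] by simp
  define ce where "ce i v = representation B v (e i)" for i v
  define cf where "cf i v = representation B v (f i)" for i v
  have hom: "module_hom scale (*) (\<lambda>v. representation B v b)" for b
    by (rule module_hom_linearI[OF linear_representation[OF B(1,2)]])
  have eB: "e i \<in> B" if "i \<in> {1..m}" for i using that B(3) us by auto
  have fB: "f i \<in> B" if "i \<in> {1..2*k}" for i using that B(3) us by auto
  have ef: "e i \<noteq> f j" if "i \<in> {1..m}" "j \<in> {1..2*k}" for i j
    using that inj(3) by blast
  have "mu2_in_leibniz scale bracket m k N e f ce cf"
  proof (intro mu2_in_leibniz.intro mu2_in_leibniz_axioms.intro)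
    show "leibniz_algebra scale bracket" by (rule leibniz_algebra_axioms)
    show "m \<ge> 4" "k \<ge> 2" "two_sided_ideal N" "mu2_products (m + 2*k) k e f" by fact+
    show "e i \<in> N" if "i \<in> {1..m}" for i unfolding N us using that by (intro span_base) auto
    show "f i \<in> N" if "i \<in> {1..2*k}" for i unfolding N us using that by (intro span_base) auto
    show "module_hom scale (*) (ce i)" "module_hom scale (*) (cf i)" for i
      unfolding ce_def cf_def by (rule hom)+
    show "ce i (e j) = (if j = i then 1 else 0)" if "i \<in> {1..m}" "j \<in> {1..m}" for i j
      using that inj_on_eq_iff[OF inj(1)] by (simp add: ce_def rep eB)
    show "ce i (f j) = 0" if "i \<in> {1..m}" "j \<in> {1..2*k}" for i j
      using that ef by (simp add: ce_def rep fB)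
    show "cf i (e j) = 0" if "i \<in> {1..2*k}" "j \<in> {1..m}" for i j
      using that ef[of j i] by (simp add: cf_def rep eB)
    show "cf i (f j) = (if j = i then 1 else 0)" if "i \<in> {1..2*k}" "j \<in> {1..2*k}" for i j
      using that inj_on_eq_iff[OF inj(2)] by (simp add: cf_def rep fB)
    fix v assume v: "v \<in> N"
    have "representation B v = representation (set ?us) v"
      using representation_extend[OF B(1) _ B(3)] v N by simp
    then have "v = (\<Sum>b\<in>set ?us. scale (representation B v b) b)"
      using sum_representation_eq[OF ind_us, of v "set ?us"] v N by simp
    also have "\<dots> = (\<Sum>b\<in>e ` {1..m}. scale (representation B v b) b)
        + (\<Sum>b\<in>f ` {1..2*k}. scale (representation B v b) b)"
      unfolding us by (rule sum.union_disjoint) (use inj in auto)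
    also have "\<dots> = (\<Sum>i = 1..m. scale (ce i v) (e i)) + (\<Sum>j = 1..2*k. scale (cf j v) (f j))"
      using inj by (simp add: sum.reindex ce_def cf_def)
    finally show "v = (\<Sum>i = 1..m. scale (ce i v) (e i)) + (\<Sum>j = 1..2*k. scale (cf j v) (f j))" .
  qed
  then show ?thesis by blast
qed

text \<open>Modulo $N$ write $[x,x] = c x$. Since $[x,[x,x]] = 0$, also $c^2 x \in N$, so $c = 0$ unless $x = 0$.\<close>

lemma square_in_ideal:
  assumes ideal: "two_sided_ideal N" and span: "span (N \<union> {x}) = UNIV"
    and disj: "N \<inter> span {x} = {0}"
  shows "bracket x x \<in> N"
proof -
  have sub: "subspace N" and br: "\<And>u. u \<in> N \<Longrightarrow> bracket x u \<in> N"
    using ideal by (auto simp: two_sided_ideal_def)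
  have "bracket x x \<in> span (insert x N)" using span by simp
  then obtain c where "bracket x x - scale c x \<in> span N" using span_breakdown_eq by blast
  then have u: "bracket x x - scale c x \<in> N" (is "?u \<in> N") using span_eq_iff sub by metis
  have "0 = bracket x (scale c x + ?u)" by (simp add: bracket_square_right)
  also have "\<dots> = scale c (bracket x x) + bracket x ?u"
    by (simp only: bracket_add_right bracket_scale_right)
  also have "\<dots> = scale (c * c) x + (scale c ?u + bracket x ?u)"
    by (simp add: scale_right_diff_distrib)
  finally have "scale (c * c) x = - (scale c ?u + bracket x ?u)"
    by (metis eq_neg_iff_add_eq_0)
  also have "\<dots> \<in> N"
    by (intro subspace_neg[OF sub] subspace_add[OF sub] subspace_scale[OF sub] u br)
  finally have "scale (c * c) x \<in> N \<inter> span {x}" by (simp add: span_base span_scale)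
  then have "scale (c * c) x = 0" using disj by blast
  then have "c = 0 \<or> x = 0" by simp
  then have z: "scale c x = 0" by auto
  show ?thesis using u unfolding z by simp
qed

end

theorem theorem4p6:
  fixes scale :: "complex \<Rightarrow> 'a::ab_group_add \<Rightarrow> 'a"
    and br :: "'a \<Rightarrow> 'a \<Rightarrow> 'a"
    and n k :: nat
    and N F :: "'a set"
    and e f :: "nat \<Rightarrow> 'a"
    and x :: 'a
    and lam :: complex
    and eps :: "'a \<Rightarrow> 'a"
  assumes "k \<ge> 2" and "n - 2*k \<ge> 4"
    and "leibniz_algebra scale br"
    and "leibniz_algebra.solvable scale br UNIV"
    and "vector_space.dim scale UNIV = n + 1"
    and "leibniz_algebra.is_nilradical scale br N"
    and "leibniz_algebra.is_basis scale (leibniz_algebra.mu2_vectors n k e f) N"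
    and "leibniz_algebra.mu2_products br n k e f"
    and "N \<inter> module.span scale {x} = {0}"
    and "module.span scale (N \<union> module.span scale {x}) = UNIV"
    and F_def: "F = module.span scale (f ` {1..k})"
    and eps_def: "eps = (\<lambda>v. leibniz_algebra.projection_along F
           (module.span scale (e ` {1..n - 2*k} \<union> f ` {k+1..2*k}))
           (leibniz_algebra.right_mult br x v))"
    and "\<exists>gs. leibniz_algebra.is_basis scale gs F \<and>
           leibniz_algebra.has_matrix scale eps gs (jordan_block k lam)"
    and "lam \<noteq> 0"
  shows "\<exists>(\<alpha>::complex) (\<beta>::complex) (\<gamma>::complex) (e'::nat \<Rightarrow> 'a) (f'::nat \<Rightarrow> 'a) (x'::'a).
      leibniz_algebra.is_basis scale (leibniz_algebra.mu2_vectors n k e' f' @ [x']) UNIV \<and>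
      leibniz_algebra.mu2_products br n k e' f' \<and>
      br (e' 1) x' = f' 1 + scale \<alpha> (f' (k + 1)) \<and>
      br (e' 2) x' = e' 2 + f' (k + 1) \<and>
      (\<forall>i\<in>{3..n - 2*k}. br (e' i) x' = scale (of_nat (i - 1)) (e' i)) \<and>
      (\<forall>i\<in>{1..k - 1}. br (f' i) x' = f' i + f' (i + 1)) \<and>
      (\<forall>i\<in>{1..k - 1}. br x' (f' i) = - (f' i + f' (i + 1))) \<and>
      br (f' k) x' = f' k \<and>
      br x' (f' k) = - f' k \<and>
      br (f' (k + 1)) x' = f' (k + 2) \<and>
      (\<forall>i\<in>{k + 2..2*k - 1}. br (f' i) x' = f' i + f' (i + 1)) \<and>
      br (f' (2*k)) x' = f' (2*k) \<and>
      br x' (e' 1) = - f' 1 + scale \<beta> (\<Sum>i = 1..k. scale ((-1) ^ (i - 1)) (f' (k + i))) \<and>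
      (\<forall>i\<in>{2..n - 2*k}. br x' (e' i) = 0) \<and>
      (\<forall>i\<in>{k + 1..2*k}. br x' (f' i) = 0) \<and>
      br x' x' = scale \<gamma> (f' (k + 1))"
proof -
  interpret R: leibniz_algebra scale br by fact
  define m where "m = n - 2*k"
  have n: "n = m + 2*k" and m4: "m \<ge> 4" using \<open>n - 2*k \<ge> 4\<close> by (auto simp: m_def)
  have ideal: "R.two_sided_ideal N" using assms(6) by (simp add: R.is_nilradical_def)
  have span: "R.span (N \<union> {x}) = UNIV"
  proof -
    have "N \<union> R.span {x} \<subseteq> R.span (N \<union> {x})"
      using R.span_mono[of "{x}" "N \<union> {x}"] by (auto intro: R.span_base)
    then show ?thesis using assms(10) R.span_minimal[OF _ R.subspace_span] by blast
  qed
  have "\<exists>ce cf. mu2_in_leibniz scale br m k N e f ce cf"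
    by (rule R.mu2_coordinates[OF m4 \<open>k \<ge> 2\<close> ideal _ _ span]) (use assms(5,7,8) n in simp_all)
  then obtain ce cf where "mu2_in_leibniz scale br m k N e f ce cf" by blast
  then interpret mu2_in_leibniz scale br m k N e f ce cf .
  have xx: "br x x \<in> N" by (rule R.square_in_ideal[OF ideal span]) fact
  obtain gs where gs: "R.is_basis gs F" and mat: "R.has_matrix eps gs (jordan_block k lam)"
    using assms(13) by blast
  have span_gs: "R.span (set gs) = R.span (f ` {1..k})" using gs by (simp add: R.is_basis_def F_def)
  have len: "length gs = k" using mat by (auto simp: R.has_matrix_def jordan_block_def)
  have eps: "eps v = P (br v x)" if "v \<in> R.span (f ` {1..k})" for v
    unfolding eps_def F_def R.right_mult_def m_def[symmetric]
    by (intro projection_along_F N_closed K_N F_K that)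
  have eps_gs: "P (br (gs ! j) x) = (\<Sum>i<k. scale (jordan_block k lam $$ (i, j)) (gs ! i))" if "j < k" for j
  proof -
    have "gs ! j \<in> R.span (f ` {1..k})" using that len span_gs by (metis nth_mem R.span_base)
    then show ?thesis using mat that len by (simp add: R.has_matrix_def eps[symmetric])
  qed
  have g0: "P (br (gs ! 0) x) = scale lam (gs ! 0)"
  proof -
    have "(\<Sum>i<k. scale (jordan_block k lam $$ (i, 0)) (gs ! i))
        = (\<Sum>i<k. if i = 0 then scale lam (gs ! 0) else 0)"
      by (intro sum.cong) auto
    then show ?thesis using eps_gs[of 0] \<open>k \<ge> 2\<close> by simp
  qed
  have gS: "P (br (gs ! Suc j) x) = scale lam (gs ! Suc j) + gs ! j" if "Suc j < k" for j
  proof -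
    have "(\<Sum>i<k. scale (jordan_block k lam $$ (i, Suc j)) (gs ! i))
        = (\<Sum>i<k. if i = Suc j then scale lam (gs ! Suc j) else 0) + (\<Sum>i<k. if i = j then gs ! j else 0)"
      unfolding sum.distrib[symmetric] using that by (intro sum.cong) auto
    then show ?thesis using eps_gs[of "Suc j"] that by simp
  qed
  obtain h0 where "adapted (scale (1 / lam) x) h0"
    using adapted_from_jordan_block[OF span_gs len g0 gS \<open>lam \<noteq> 0\<close> xx] by blast
  then obtain y h \<xi> \<alpha> \<gamma> where y: "y \<in> N" and nf: "normal_form (scale (1 / lam) x + y) h \<xi> \<alpha> \<gamma>"
    using normal_form_exists by blast
  have span': "R.span (N \<union> {scale (1 / lam) x + y}) = UNIV" (is "?W = UNIV")
  proof -
    have "scale lam ((scale (1 / lam) x + y) - y) \<in> ?W"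
      using y by (intro R.span_scale R.span_diff R.span_base) auto
    then have "x \<in> ?W" using \<open>lam \<noteq> 0\<close> by simp
    then have "N \<union> {x} \<subseteq> ?W" by (auto intro: R.span_base)
    then show ?thesis using span R.span_minimal[OF _ R.subspace_span] by blast
  qed
  have dim: "R.dim UNIV = m + 2*k + 1" using assms(5) n by simp
  show ?thesis
    using normal_form_table[OF nf span' dim] unfolding n diff_add_inverse2 .
qed

end
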